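(* The class of reductive Lie algebras is closed under taking fixed points of involutions: if $\mathfrak g$ is a (real or complex, finite-dimensional) reductive Lie algebra and $\iota$ is an involution of $\mathfrak g$ (an automorphism with $\iota^2=1$), then the subalgebra $\mathfrak g^\iota$ of fixed points of $\iota$ is reductive.
   Context: A reductive Lie algebra is a Lie algebra whose adjoint representation is completely reducible; equivalently $\mathfrak g=[\mathfrak g,\mathfrak g]\oplus\mathfrak z(\mathfrak g)$ with $[\mathfrak g,\mathfrak g]$ semisimple. *)

theory Defs
  imports Complex_Main
begin

text \<open>
  The carrier \<open>L\<close> is a subspace of an ambient vector space and the bracket is only constrained
  on \<open>L\<close>, so that Lie algebras (\<open>L = UNIV\<close> included) and their subalgebras are instances of one
  and the same notion. No finiteness of the dimension is built in.
\<close>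

locale lie_algebra = vector_space scale
  for scale :: "'k::field \<Rightarrow> 'v::ab_group_add \<Rightarrow> 'v" +
  fixes L :: "'v set" and bracket :: "'v \<Rightarrow> 'v \<Rightarrow> 'v"
  assumes subspace_carrier: "subspace L"
    and bracket_closed: "\<lbrakk>x \<in> L; y \<in> L\<rbrakk> \<Longrightarrow> bracket x y \<in> L"
    and bracket_add_left:
      "\<lbrakk>x \<in> L; y \<in> L; z \<in> L\<rbrakk> \<Longrightarrow> bracket (x + y) z = bracket x z + bracket y z"
    and bracket_add_right:
      "\<lbrakk>x \<in> L; y \<in> L; z \<in> L\<rbrakk> \<Longrightarrow> bracket x (y + z) = bracket x y + bracket x z"
    and bracket_scale_left:
      "\<lbrakk>x \<in> L; y \<in> L\<rbrakk> \<Longrightarrow> bracket (scale c x) y = scale c (bracket x y)"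
    and bracket_scale_right:
      "\<lbrakk>x \<in> L; y \<in> L\<rbrakk> \<Longrightarrow> bracket x (scale c y) = scale c (bracket x y)"
    and bracket_self: "x \<in> L \<Longrightarrow> bracket x x = 0"
    and jacobi:
      "\<lbrakk>x \<in> L; y \<in> L; z \<in> L\<rbrakk> \<Longrightarrow>
        bracket x (bracket y z) + bracket y (bracket z x) + bracket z (bracket x y) = 0"
begin

definition finite_dimensional :: bool where
  "finite_dimensional \<longleftrightarrow> (\<exists>B. finite B \<and> L = span B)"

definition automorphism :: "('v \<Rightarrow> 'v) \<Rightarrow> bool" where
  "automorphism \<phi> \<longleftrightarrow>
     bij_betw \<phi> L L \<and>
     (\<forall>x\<in>L. \<forall>y\<in>L. \<phi> (x + y) = \<phi> x + \<phi> y) \<and>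
     (\<forall>c. \<forall>x\<in>L. \<phi> (scale c x) = scale c (\<phi> x)) \<and>
     (\<forall>x\<in>L. \<forall>y\<in>L. \<phi> (bracket x y) = bracket (\<phi> x) (\<phi> y))"

text \<open>The identity counts as an involution.\<close>

definition involution :: "('v \<Rightarrow> 'v) \<Rightarrow> bool" where
  "involution \<iota> \<longleftrightarrow> automorphism \<iota> \<and> (\<forall>x\<in>L. \<iota> (\<iota> x) = x)"

definition fixed_points :: "('v \<Rightarrow> 'v) \<Rightarrow> 'v set" where
  "fixed_points \<phi> = {x \<in> L. \<phi> x = x}"

lemma bracket_anticommute:
  assumes "x \<in> L" "y \<in> L"
  shows "bracket x y = - bracket y x"
proof -
  have "x + y \<in> L" using assms subspace_carrier by (rule subspace_add[rotated])
  then have "bracket (x + y) (x + y) = 0" by (rule bracket_self)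
  moreover have "bracket (x + y) (x + y) = bracket x y + bracket y x"
    using assms \<open>x + y \<in> L\<close> bracket_self[of x] bracket_self[of y]
    by (simp only: bracket_add_left bracket_add_right add_0_left add_0_right add.commute)
  ultimately have "bracket x y + bracket y x = 0" by simp
  then show ?thesis by (simp add: eq_neg_iff_add_eq_0)
qed

end

locale lie_representation =
  lie_algebra scale L bracket + V: vector_space scaleV
  for scale :: "'k::field \<Rightarrow> 'v::ab_group_add \<Rightarrow> 'v" and L bracket
    and scaleV :: "'k \<Rightarrow> 'w::ab_group_add \<Rightarrow> 'w" +
  fixes V :: "'w set" and \<rho> :: "'v \<Rightarrow> 'w \<Rightarrow> 'w"
  assumes subspace_space: "V.subspace V"
    and action_closed: "\<lbrakk>x \<in> L; v \<in> V\<rbrakk> \<Longrightarrow> \<rho> x v \<in> V"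
    and action_add_left: "\<lbrakk>x \<in> L; y \<in> L; v \<in> V\<rbrakk> \<Longrightarrow> \<rho> (x + y) v = \<rho> x v + \<rho> y v"
    and action_add_right: "\<lbrakk>x \<in> L; v \<in> V; w \<in> V\<rbrakk> \<Longrightarrow> \<rho> x (v + w) = \<rho> x v + \<rho> x w"
    and action_scale_left: "\<lbrakk>x \<in> L; v \<in> V\<rbrakk> \<Longrightarrow> \<rho> (scale c x) v = scaleV c (\<rho> x v)"
    and action_scale_right: "\<lbrakk>x \<in> L; v \<in> V\<rbrakk> \<Longrightarrow> \<rho> x (scaleV c v) = scaleV c (\<rho> x v)"
    and action_bracket:
      "\<lbrakk>x \<in> L; y \<in> L; v \<in> V\<rbrakk> \<Longrightarrow> \<rho> (bracket x y) v = \<rho> x (\<rho> y v) - \<rho> y (\<rho> x v)"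
begin

definition invariant_subspace :: "'w set \<Rightarrow> bool" where
  "invariant_subspace W \<longleftrightarrow> V.subspace W \<and> W \<subseteq> V \<and> (\<forall>x\<in>L. \<forall>w\<in>W. \<rho> x w \<in> W)"

definition completely_reducible :: bool where
  "completely_reducible \<longleftrightarrow>
     (\<forall>W. invariant_subspace W \<longrightarrow>
        (\<exists>W'. invariant_subspace W' \<and> W \<inter> W' = {0} \<and> V = {w + w' | w w'. w \<in> W \<and> w' \<in> W'}))"

end

sublocale lie_algebra \<subseteq> adjoint: lie_representation scale L bracket scale L bracket
proof (unfold_locales, goal_cases)
  case (7 x y z)
  note xyz = 7
  have "bracket (bracket x y) z = - bracket z (bracket x y)"
    using xyz by (intro bracket_anticommute bracket_closed)
  moreover have "bracket y (bracket z x) = - bracket y (bracket x z)"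
  proof -
    have "bracket z x = scale (- 1) (bracket x z)"
      using xyz bracket_anticommute[of z x] by simp
    then have "bracket y (bracket z x) = scale (- 1) (bracket y (bracket x z))"
      using xyz by (simp only: bracket_scale_right bracket_closed)
    then show ?thesis by simp
  qed
  ultimately show ?case
    using jacobi[of x y z] xyz by (simp add: algebra_simps)
qed (simp_all add: subspace_carrier bracket_closed bracket_add_left bracket_add_right
      bracket_scale_left bracket_scale_right)

locale reductive_lie_algebra = lie_algebra +
  assumes adjoint_completely_reducible: "adjoint.completely_reducible"

end

theory Submission
  imports Defs "HOL-Computational_Algebra.Fundamental_Theorem_Algebra"
    "HOL-Library.Function_Algebras"
begin

text \<open>
  Let \<open>\<kappa> x y = trace (ad x \<circ> ad y)\<close> be the Killing form of the reductive algebra \<open>\<gg>\<close>. A form of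
  Cartan's criterion shows that the radical of \<open>\<kappa>\<close> is central: if \<open>x\<close> is a sum of brackets \<open>[a, b]\<close>
  with \<open>a\<close> in the radical, then \<open>ad x\<close> is nilpotent (eigenvalues are
  taken after complexification), and Engel's theorem together with complements of
  ideals forces \<open>x\<close> into the center. An involution \<open>\<iota>\<close> preserves \<open>\<kappa>\<close>, so its eigenspaces for
  \<open>1\<close> and \<open>-1\<close> are \<open>\<kappa>\<close>-orthogonal and the radical of the restriction of \<open>\<kappa>\<close> to the fixed point
  algebra \<open>K\<close> is central in \<open>\<gg>\<close> as well. For an ideal \<open>P\<close> of \<open>K\<close> the
  radical of \<open>\<kappa>\<close> on \<open>N = P \<inter> [K, K]\<close> is an abelian ideal of \<open>K\<close>. The same nilpotency argument
  shows that it is \<open>\<kappa>\<close>-orthogonal to \<open>K\<close>, hence zero. Thus \<open>K\<close> is the sum of \<open>N\<close> and its orthogonal space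
  \<open>N'\<close>, and any vector space complement of \<open>P \<inter> N'\<close> in \<open>N'\<close> that contains \<open>[K, K] \<inter> N'\<close> is an
  ideal complementary to \<open>P\<close>.
\<close>

section \<open>Linear algebra and traces in coordinates\<close>

context vector_space
begin

text \<open>A vector of \<open>U\<close> outside \<open>W\<close> enlarges a basis of
  \<open>W\<close> to an independent set, which cannot outnumber a basis of \<open>U\<close>. The
  bound by a finite \<open>B\<close> matters because \<open>dim\<close> counts with
  \<open>card\<close>, which is 0 on infinite sets.\<close>

lemma dim_strict_mono:
  assumes B: "finite B" "U \<subseteq> span B" and W: "subspace W" and WU: "W \<subset> U"
  shows "dim W < dim U"
proof -
  obtain C where C: "C \<subseteq> W" "independent C" "W \<subseteq> span C" "card C = dim W"
    by (rule basis_exists)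
  obtain D where D: "D \<subseteq> U" "independent D" "U \<subseteq> span D" "card D = dim U"
    by (rule basis_exists)
  have finD: "finite D"
    using independent_span_bound[OF B(1) D(2)] D(1) B(2) by blast
  obtain v where v: "v \<in> U" "v \<notin> W" using WU by blast
  have "span C \<subseteq> W" using C(1) W by (rule span_minimal)
  then have nv: "v \<notin> span C" using v by blast
  have ind: "independent (insert v C)"
    using C(2) nv by (rule independent_insertI[rotated])
  have "insert v C \<subseteq> span D" using v C(1) WU D(3) by blast
  then have "finite (insert v C) \<and> card (insert v C) \<le> card D"
    by (rule independent_span_bound[OF finD ind])
  moreover have "v \<notin> C" using nv span_base by blast
  ultimately show ?thesis using C(4) D(4) by auto
qed

text \<open>Dimensions are bounded by \<open>card B\<close>, so some admissible subspace has the
  greatest dimension, and by \<open>dim_strict_mono\<close> nothing admissible lies strictly above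
  it. It supplies the maximal subalgebra in Engel's theorem and the complement in
  \<open>reductive_subalgebra\<close>.\<close>

lemma maximal_subspace_exists:
  assumes B: "finite B" and X: "P X"
    and P: "\<And>Y. P Y \<Longrightarrow> subspace Y \<and> Y \<subseteq> span B"
  obtains Y where "P Y" "\<forall>Z. P Z \<longrightarrow> Y \<subseteq> Z \<longrightarrow> Z = Y"
proof -
  have bd: "\<forall>Y. P Y \<longrightarrow> dim Y \<le> card B"
    using P dim_le_card[OF _ B] by blast
  obtain Y where Y: "P Y" "\<forall>Z. P Z \<longrightarrow> dim Z \<le> dim Y"
    using ex_has_greatest_nat[of P X dim "Suc (card B)"] X bd by (auto simp: less_Suc_eq_le)
  show thesis
  proof (rule that[OF Y(1)], intro allI impI)
    fix Z assume Z: "P Z" "Y \<subseteq> Z"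
    show "Z = Y"
    proof (rule ccontr)
      assume "Z \<noteq> Y"
      then have "dim Y < dim Z"
        using Z P[OF Y(1)] P[OF Z(1)] dim_strict_mono[OF B, of Z Y] by blast
      then show False using Y(2) Z(1) by (simp add: leD)
    qed
  qed
qed

text \<open>The clause on the range is what later places all values of the extension in a given
  subspace, as projections and \<open>endo\<close> require.\<close>

lemma linear_extension:
  assumes "independent C"
  obtains g where "Vector_Spaces.linear scale scale g" "\<And>c. c \<in> C \<Longrightarrow> g c = f c"
    "range g = span (f ` C)"
proof -
  interpret vector_space_pair scale scale by unfold_locales
  show thesis using linear_independent_extend_subspace[OF assms, of f] that by blast
qed

lemma subspace_basis:
  assumes "subspace W"
  obtains C where "independent C" "span C = W"
proof -
  obtain C where C: "C \<subseteq> W" "independent C" "W \<subseteq> span C" by (rule maximal_independent_subset)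
  then show thesis using that span_minimal[OF C(1) assms] by blast
qed

lemma subspace_finite_basis:
  assumes "finite B" "subspace W" "W \<subseteq> span B"
  obtains C where "finite C" "independent C" "span C = W"
proof -
  obtain C where C: "independent C" "span C = W" using assms(2) by (rule subspace_basis)
  have "C \<subseteq> span B" using C(2) assms(3) span_superset by blast
  then show thesis using that C independent_span_bound[OF assms(1) C(1)] by blast
qed

lemma projection_exists:
  assumes "subspace W"
  obtains g where "Vector_Spaces.linear scale scale g" "\<And>v. g v \<in> W" "\<And>w. w \<in> W \<Longrightarrow> g w = w"
proof -
  obtain C where C: "independent C" "span C = W" using assms by (rule subspace_basis)
  obtain g where g: "Vector_Spaces.linear scale scale g" "\<And>c. c \<in> C \<Longrightarrow> g c = id c"
    "range g = span (id ` C)" by (rule linear_extension[OF C(1), where f = id]) blast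
  interpret g: Vector_Spaces.linear scale scale g by fact
  have "g w = w" if "w \<in> span C" for w
    using that
    by (induction rule: span_induct_alt) (simp_all add: g.zero g.add g.scale g(2))
  then show thesis using that[of g] g(1,3) C(2) by auto
qed

text \<open>The map \<open>v \<mapsto> (\<beta> v c)\<^sub>c\<close>, with \<open>c\<close> running through a basis of \<open>N\<close>, is an injective
  endomorphism of the finite-dimensional space \<open>N\<close>, hence onto.\<close>

lemma orthogonal_decomposition:
  assumes B: "finite B" and N: "subspace N" "N \<subseteq> span B"
    and add1: "\<And>x y z. \<beta> (x + y) z = \<beta> x z + \<beta> y z"
    and scale1: "\<And>c x z. \<beta> (scale c x) z = c * \<beta> x z"
    and add2: "\<And>x y z. \<beta> z (x + y) = \<beta> z x + \<beta> z y"
    and scale2: "\<And>c x z. \<beta> z (scale c x) = c * \<beta> z x"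
    and nondeg: "\<And>n. n \<in> N \<Longrightarrow> \<forall>m\<in>N. \<beta> n m = 0 \<Longrightarrow> n = 0"
  obtains n where "n \<in> N" "\<forall>m\<in>N. \<beta> (y - n) m = 0"
proof -
  obtain C where C: "finite C" "independent C" "span C = N"
    using B N by (rule subspace_finite_basis)
  define T where "T v = (\<Sum>c\<in>C. scale (\<beta> v c) c)" for v
  have T_lin: "Vector_Spaces.linear scale scale T"
    unfolding Vector_Spaces.linear_iff T_def
    by (auto simp: add1 scale1 scale_left_distrib sum.distrib scale_sum_right vector_space_axioms)
  interpret T: Vector_Spaces.linear scale scale T by fact
  have T_in: "T v \<in> N" for v
    unfolding T_def C(3)[symmetric] by (intro span_sum span_scale span_base)
  have beta_zero: "\<beta> v m = 0" if "T v = 0" "m \<in> N" for v m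
  proof -
    have *: "\<beta> v c = 0" if "c \<in> C" for c
      using independentD[OF C(2) C(1) subset_refl, of "\<beta> v"] that \<open>T v = 0\<close> by (simp add: T_def)
    have zero: "\<beta> v 0 = 0" using scale2[of v 0 0] by simp
    have "m \<in> span C" using that C(3) by simp
    then show ?thesis
      by (induction rule: span_induct_alt) (simp_all add: zero add2 scale2 *)
  qed
  have inj: "inj_on T (span C)"
  proof (rule inj_onI)
    fix u v assume uv: "u \<in> span C" "v \<in> span C" "T u = T v"
    then have "T (u - v) = 0" by (simp add: T.diff)
    moreover have "u - v \<in> N" using uv C(3) span_diff by blast
    ultimately have "u - v = 0" using nondeg beta_zero by blast
    then show "u = v" by simp
  qed
  interpret VP: vector_space_pair scale scale by unfold_locales
  have ind: "independent (T ` C)"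
    by (rule VP.linear_independent_injective_image[OF T_lin C(2) inj])
  have card: "card (T ` C) = card C"
    using inj span_superset by (intro card_image) (rule inj_on_subset)
  have sub: "span (T ` C) \<subseteq> N" using T_in N(1) by (intro span_minimal) auto
  have dims: "dim (span (T ` C)) = dim N"
    using dim_span_eq_card_independent[OF ind] dim_span_eq_card_independent[OF C(2)] card C(3)
    by simp
  have "span (T ` C) = N"
    using dim_strict_mono[OF B N(2) subspace_span, of "T ` C"] sub dims by (auto simp: psubset_eq)
  moreover have "span (T ` C) = T ` span C" by (rule T.span_image)
  ultimately have "T y \<in> T ` N" using T_in C(3) by simp
  then obtain n where n: "n \<in> N" "T y = T n" by blast
  then have "T (y - n) = 0" by (simp add: T.diff)
  then show thesis using that n(1) beta_zero by blast
qed

text \<open>The exponent may depend on the vector; a sum is killed by the sum of two exponents.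
  Local nilpotency can therefore be checked on a spanning set.\<close>

lemma subspace_locally_nilpotent:
  assumes "Vector_Spaces.linear scale scale f"
  shows "subspace {v. \<exists>n. (f ^^ n) v = 0}"
proof -
  interpret f: Vector_Spaces.linear scale scale f by fact
  have add: "(f ^^ n) (x + y) = (f ^^ n) x + (f ^^ n) y" for n x y
    by (induction n) (simp_all add: f.add)
  have scale: "(f ^^ n) (scale c x) = scale c ((f ^^ n) x)" for n c x
    by (induction n) (simp_all add: f.scale)
  have zero: "(f ^^ n) 0 = 0" for n
    using scale[of n 0 0] by simp
  show ?thesis
  proof (rule subspaceI)
    fix x y assume "x \<in> {v. \<exists>n. (f ^^ n) v = 0}" "y \<in> {v. \<exists>n. (f ^^ n) v = 0}"
    then obtain m n where "(f ^^ m) x = 0" "(f ^^ n) y = 0" by blast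
    then have "(f ^^ (n + m)) x = 0" "(f ^^ (m + n)) y = 0"
      unfolding funpow_add by (simp_all add: zero)
    then have "(f ^^ (m + n)) (x + y) = 0" by (simp add: add add.commute)
    then show "x + y \<in> {v. \<exists>n. (f ^^ n) v = 0}" by blast
  next
    fix c x assume "x \<in> {v. \<exists>n. (f ^^ n) v = 0}"
    then show "scale c x \<in> {v. \<exists>n. (f ^^ n) v = 0}" by (auto simp: scale)
  qed (auto simp: zero)
qed

end

text \<open>The functionals \<open>coord i\<close> are linear on the whole ambient type, although
  the \<open>e i\<close> span only \<open>space\<close>; \<open>coord_basis\<close> makes the
  \<open>e i\<close> independent. Operators can thus be total functions, and only vectors need to be
  located in \<open>space\<close>.\<close>

locale coordinate_space = vector_space scale
  for scale :: "'k::field \<Rightarrow> 'v::ab_group_add \<Rightarrow> 'v" +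
  fixes I :: "'i set" and e :: "'i \<Rightarrow> 'v" and coord :: "'i \<Rightarrow> 'v \<Rightarrow> 'k"
  assumes finite_index: "finite I"
    and coord_add: "i \<in> I \<Longrightarrow> coord i (x + y) = coord i x + coord i y"
    and coord_scale: "i \<in> I \<Longrightarrow> coord i (scale c x) = c * coord i x"
    and coord_basis: "i \<in> I \<Longrightarrow> j \<in> I \<Longrightarrow> coord i (e j) = (if i = j then 1 else 0)"
begin

definition space :: "'v set" where
  "space = span (e ` I)"

definition trace :: "('v \<Rightarrow> 'v) \<Rightarrow> 'k" where
  "trace f = (\<Sum>i\<in>I. coord i (f (e i)))"

text \<open>Linearity is required on the ambient type and the values are forced into
  \<open>space\<close>, so sums and composites obey their identities without membership premises,
  and \<open>trace\<close> is the trace of the restriction to \<open>space\<close>.\<close>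

definition endo :: "('v \<Rightarrow> 'v) \<Rightarrow> bool" where
  "endo f \<longleftrightarrow> Vector_Spaces.linear scale scale f \<and> (\<forall>v. f v \<in> space)"

lemma subspace_space: "subspace space"
  by (simp add: space_def)

lemma finite_basis: "finite (e ` I)"
  using finite_index by simp

lemma basis_in_space: "i \<in> I \<Longrightarrow> e i \<in> space"
  by (simp add: space_def span_base)

lemma coord_zero: "i \<in> I \<Longrightarrow> coord i 0 = 0"
  using coord_scale[of i 0 0] by simp

lemma coord_sum: "i \<in> I \<Longrightarrow> coord i (\<Sum>a\<in>A. g a) = (\<Sum>a\<in>A. coord i (g a))"
  by (induction A rule: infinite_finite_induct) (simp_all add: coord_zero coord_add)

lemma coord_diff: "i \<in> I \<Longrightarrow> coord i (x - y) = coord i x - coord i y"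
  using coord_add[of i "x - y" y] by simp

lemma coord_expansion: "v \<in> space \<Longrightarrow> (\<Sum>i\<in>I. scale (coord i v) (e i)) = v"
  unfolding space_def
proof (induction rule: span_induct_alt)
  case base
  then show ?case by (simp add: coord_zero)
next
  case (step c x y)
  then obtain j where j: "j \<in> I" "x = e j" by blast
  have "(\<Sum>i\<in>I. scale (coord i x) (e i)) = (\<Sum>i\<in>I. if i = j then e i else 0)"
    using j by (intro sum.cong) (auto simp: coord_basis)
  also have "\<dots> = x" using j finite_index by simp
  finally have x: "(\<Sum>i\<in>I. scale (coord i x) (e i)) = x" .
  have "(\<Sum>i\<in>I. scale (coord i (scale c x + y)) (e i))
      = scale c (\<Sum>i\<in>I. scale (coord i x) (e i)) + (\<Sum>i\<in>I. scale (coord i y) (e i))"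
    by (simp add: coord_add coord_scale scale_left_distrib sum.distrib scale_sum_right)
  then show ?case using x step.IH by simp
qed

lemma endo_add: "endo f \<Longrightarrow> f (x + y) = f x + f y"
  by (simp add: endo_def Vector_Spaces.linear_iff)

lemma endo_scale: "endo f \<Longrightarrow> f (scale c x) = scale c (f x)"
  by (simp add: endo_def Vector_Spaces.linear_iff)

lemma endo_in_space: "endo f \<Longrightarrow> f v \<in> space"
  by (simp add: endo_def)

lemma endo_zero: "endo f \<Longrightarrow> f 0 = 0"
  using endo_scale[of f 0 0] by simp

lemma endo_diff: "endo f \<Longrightarrow> f (x - y) = f x - f y"
  using endo_add[of f "x - y" y] by simp

lemma endo_sum: "endo f \<Longrightarrow> f (\<Sum>a\<in>A. g a) = (\<Sum>a\<in>A. f (g a))"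
  by (induction A rule: infinite_finite_induct) (simp_all add: endo_zero endo_add)

lemma endoI:
  assumes "\<And>x y. f (x + y) = f x + f y" "\<And>c x. f (scale c x) = scale c (f x)"
    "\<And>v. f v \<in> space"
  shows "endo f"
  using assms by (simp add: endo_def Vector_Spaces.linear_iff vector_space_axioms)

lemma endo_compose:
  assumes "endo f" "endo g" shows "endo (\<lambda>v. f (g v))"
  by (rule endoI) (simp_all add: assms endo_add endo_scale endo_in_space)

lemma endo_diff_fun:
  assumes "endo f" "endo g" shows "endo (\<lambda>v. f v - g v)"
  by (rule endoI)
    (simp_all add: assms endo_add endo_scale endo_in_space subspace_diff[OF subspace_space]
      scale_right_diff_distrib)

lemma trace_cong: "(\<And>v. v \<in> space \<Longrightarrow> f v = g v) \<Longrightarrow> trace f = trace g"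
  by (simp add: trace_def basis_in_space)

lemma trace_add: "trace (\<lambda>v. f v + g v) = trace f + trace g"
  by (simp add: trace_def coord_add sum.distrib)

lemma trace_diff: "trace (\<lambda>v. f v - g v) = trace f - trace g"
  by (simp add: trace_def coord_diff sum_subtractf)

lemma trace_scale: "trace (\<lambda>v. scale c (f v)) = c * trace f"
  by (simp add: trace_def coord_scale sum_distrib_left)

lemma trace_zero: "trace (\<lambda>v. 0) = 0"
  by (simp add: trace_def coord_zero)

lemma endo_coord:
  assumes "endo f" "v \<in> space" "i \<in> I"
  shows "coord i (f v) = (\<Sum>j\<in>I. coord j v * coord i (f (e j)))"
proof -
  have "f v = f (\<Sum>j\<in>I. scale (coord j v) (e j))" using assms(2) by (simp add: coord_expansion)
  then show ?thesis using assms by (simp add: endo_sum endo_scale coord_sum coord_scale)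
qed

lemma trace_commute:
  assumes "endo f" "endo g"
  shows "trace (\<lambda>v. f (g v)) = trace (\<lambda>v. g (f v))"
proof -
  have "trace (\<lambda>v. f (g v)) = (\<Sum>i\<in>I. \<Sum>j\<in>I. coord j (g (e i)) * coord i (f (e j)))"
    using assms by (simp add: trace_def endo_coord[of f] endo_in_space)
  also have "\<dots> = (\<Sum>j\<in>I. \<Sum>i\<in>I. coord i (f (e j)) * coord j (g (e i)))"
    by (subst sum.swap) (simp add: mult.commute)
  also have "\<dots> = trace (\<lambda>v. g (f v))"
    using assms by (simp add: trace_def endo_coord[of g] endo_in_space)
  finally show ?thesis .
qed

text \<open>Expanding \<open>f (e i)\<close> over \<open>C\<close>, then each \<open>c\<close> over
  the \<open>e i\<close>, and exchanging the two sums turns one formula into the other. It is needed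
  for a basis of generalized eigenvectors.\<close>

lemma trace_eq_basis_trace:
  assumes C: "finite C" "independent C" "span C = space" and f: "endo f"
  shows "trace f = (\<Sum>c\<in>C. representation C (f c) c)"
proof -
  let ?r = "representation C"
  have rep: "(\<Sum>c\<in>C. scale (?r v c) c) = v" if "v \<in> space" for v
    using that C by (intro sum_representation_eq) auto
  have rsum: "?r (\<Sum>i\<in>I. scale (a i) (g i)) c = (\<Sum>i\<in>I. a i * ?r (g i) c)"
    if "\<And>i. i \<in> I \<Longrightarrow> g i \<in> space" for a g c
  proof -
    have *: "g i \<in> span C" if "i \<in> I" for i using that \<open>\<And>i. i \<in> I \<Longrightarrow> g i \<in> space\<close> C(3) by simp
    have "?r (\<Sum>i\<in>I. scale (a i) (g i)) = (\<lambda>b. \<Sum>i\<in>I. ?r (scale (a i) (g i)) b)"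
      using * span_scale by (intro representation_sum[OF C(2)]) blast
    then show ?thesis using * by (simp add: representation_scale[OF C(2)])
  qed
  have "trace f = (\<Sum>i\<in>I. \<Sum>c\<in>C. ?r (f (e i)) c * coord i c)"
    unfolding trace_def
  proof (rule sum.cong[OF refl])
    fix i assume i: "i \<in> I"
    have "coord i (f (e i)) = coord i (\<Sum>c\<in>C. scale (?r (f (e i)) c) c)"
      using f by (simp add: rep endo_in_space)
    then show "coord i (f (e i)) = (\<Sum>c\<in>C. ?r (f (e i)) c * coord i c)"
      using i by (simp add: coord_sum coord_scale)
  qed
  also have "\<dots> = (\<Sum>c\<in>C. \<Sum>i\<in>I. coord i c * ?r (f (e i)) c)"
    by (subst sum.swap) (simp add: mult.commute)
  also have "\<dots> = (\<Sum>c\<in>C. ?r (f c) c)"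
  proof (rule sum.cong[OF refl])
    fix c assume "c \<in> C"
    then have c: "c \<in> space" using C(3) span_base by blast
    have "f c = f (\<Sum>i\<in>I. scale (coord i c) (e i))" using c by (simp add: coord_expansion)
    also have "\<dots> = (\<Sum>i\<in>I. scale (coord i c) (f (e i)))"
      using f by (simp add: endo_sum endo_scale)
    finally have "?r (f c) c = ?r (\<Sum>i\<in>I. scale (coord i c) (f (e i))) c" by simp
    then show "(\<Sum>i\<in>I. coord i c * ?r (f (e i)) c) = ?r (f c) c"
      using rsum[of "\<lambda>i. f (e i)"] f by (simp add: endo_in_space)
  qed
  finally show ?thesis .
qed

text \<open>If \<open>E\<close> projects onto \<open>f ` space\<close>, then \<open>trace f = trace (E \<circ> f) = trace (f \<circ> E)\<close>, and
  \<open>f \<circ> E\<close> has a smaller nilpotency index than \<open>f\<close>.\<close>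

lemma trace_nilpotent:
  assumes "endo f" "\<And>v. v \<in> space \<Longrightarrow> (f ^^ n) v = 0"
  shows "trace f = 0"
  using assms
proof (induction n arbitrary: f)
  case 0
  then have "trace f = trace (\<lambda>v. 0)"
    by (intro trace_cong) (metis funpow_0 endo_in_space)
  then show ?case by (simp add: trace_zero)
next
  case (Suc n)
  show ?case
  \<comment> \<open>The main argument splits one factor off the \<open>n\<close>-th power of
    \<open>f \<circ> E\<close>, so \<open>n\<close> must be positive; for \<open>n = 0\<close> the
    map \<open>f\<close> itself vanishes on \<open>space\<close>.\<close>
  proof (cases "n = 0")
    case True
    then show ?thesis using Suc.prems by (simp add: trace_def basis_in_space coord_zero)
  next
    case False
    interpret f: Vector_Spaces.linear scale scale f using Suc.prems(1) by (simp add: endo_def)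
    have "subspace (f ` space)" using subspace_space by (rule f.subspace_image)
    then obtain E where E: "Vector_Spaces.linear scale scale E" "\<And>v. E v \<in> f ` space"
      "\<And>w. w \<in> f ` space \<Longrightarrow> E w = w" using projection_exists by blast
    have endoE: "endo E"
      using E(1) E(2) endo_in_space[OF Suc.prems(1)] unfolding endo_def by (metis imageE)
    let ?g = "\<lambda>v. f (E v)"
    have pow: "(?g ^^ k) w = (f ^^ k) w" if "w \<in> f ` space" for k w
    proof (induction k)
      case (Suc k)
      have "(f ^^ k) w \<in> f ` space"
      proof (cases k)
        case 0
        then show ?thesis using that by simp
      next
        case (Suc l)
        have "w \<in> space" using that \<open>endo f\<close> endo_in_space by blast
        then have "(f ^^ l) w \<in> space" using \<open>endo f\<close> endo_in_space by (cases l) auto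
        then show ?thesis using Suc by simp
      qed
      then show ?case using Suc by (simp add: E(3))
    qed simp
    have "(?g ^^ n) v = 0" if "v \<in> space" for v
    proof -
      obtain u where u: "u \<in> space" "E v = f u" using E(2)[of v] by blast
      obtain m where m: "n = Suc m" using False by (cases n) auto
      have gv: "?g v \<in> f ` space" using endoE endo_in_space by blast
      have "(?g ^^ n) v = (?g ^^ m) (?g v)" by (simp only: m funpow_Suc_right comp_apply)
      also have "\<dots> = (f ^^ m) (f (f u))" using pow[OF gv] u(2) by simp
      also have "\<dots> = (f ^^ Suc n) u" by (simp only: m funpow_Suc_right comp_apply)
      finally show ?thesis using Suc.prems(2)[OF u(1)] by simp
    qed
    then have "trace ?g = 0"
      by (rule Suc.IH[OF endo_compose[OF Suc.prems(1) endoE]])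
    moreover have "trace ?g = trace (\<lambda>v. E (f v))"
      using Suc.prems(1) endoE by (rule trace_commute)
    moreover have "trace (\<lambda>v. E (f v)) = trace f"
      by (rule trace_cong) (simp add: E(3))
    ultimately show ?thesis by simp
  qed
qed

text \<open>There are finitely many basis vectors, so the sum of their exponents is an exponent
  valid on all of \<open>space\<close>.\<close>

lemma trace_locally_nilpotent:
  assumes f: "endo f" and nil: "\<And>v. v \<in> space \<Longrightarrow> \<exists>n. (f ^^ n) v = 0"
  shows "trace f = 0"
proof -
  have scale: "(f ^^ n) (scale c x) = scale c ((f ^^ n) x)" for n c x
    by (induction n) (simp_all add: endo_scale[OF f])
  have sum: "(f ^^ n) (\<Sum>a\<in>A. g a) = (\<Sum>a\<in>A. (f ^^ n) (g a))" for n A and g :: "'i \<Rightarrow> 'v"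
    by (induction n) (simp_all add: endo_sum[OF f])
  have zero: "(f ^^ n) 0 = 0" for n
    using scale[of n 0 0] by simp
  have "\<forall>i\<in>I. \<exists>n. (f ^^ n) (e i) = 0" using nil basis_in_space by blast
  then obtain k where k: "\<And>i. i \<in> I \<Longrightarrow> (f ^^ k i) (e i) = 0" by metis
  define n where "n = (\<Sum>i\<in>I. k i)"
  have n: "(f ^^ n) (e i) = 0" if "i \<in> I" for i
  proof -
    have "k i \<le> n" unfolding n_def using that finite_index by (intro member_le_sum) auto
    then have "n = (n - k i) + k i" by simp
    then have "(f ^^ n) (e i) = (f ^^ (n - k i)) ((f ^^ k i) (e i))"
      by (metis funpow_add comp_apply)
    then show ?thesis by (simp only: k[OF that] zero)
  qed
  have "(f ^^ n) v = 0" if "v \<in> space" for v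
  proof -
    have "(f ^^ n) v = (f ^^ n) (\<Sum>i\<in>I. scale (coord i v) (e i))"
      using that by (simp add: coord_expansion)
    then show ?thesis by (simp add: sum scale n)
  qed
  then show ?thesis using trace_nilpotent[OF f] by blast
qed

end

section \<open>Lie algebras in coordinates and the theorem of Engel\<close>

text \<open>The bracket is bilinear on the ambient type with values in \<open>space\<close>, which
  makes every \<open>br x\<close> an \<open>endo\<close>. The Jacobi identity is stated as
  \<open>br_br\<close>, saying that \<open>ad\<close> turns brackets into commutators.\<close>

locale coordinate_lie_algebra = coordinate_space scale I e coord
  for scale :: "'k::field \<Rightarrow> 'v::ab_group_add \<Rightarrow> 'v" and I :: "'i set" and e coord +
  fixes br :: "'v \<Rightarrow> 'v \<Rightarrow> 'v"
  assumes br_add_left: "br (x + y) z = br x z + br y z"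
    and br_scale_left: "br (scale c x) z = scale c (br x z)"
    and br_add_right: "br z (x + y) = br z x + br z y"
    and br_scale_right: "br z (scale c x) = scale c (br z x)"
    and br_in_space: "br x y \<in> space"
    and br_self [simp]: "br x x = 0"
    and br_br: "br (br x y) v = br x (br y v) - br y (br x v)"
begin

lemma endo_br: "endo (br x)"
  by (rule endoI) (simp_all add: br_add_right br_scale_right br_in_space)

lemma br_zero [simp]: "br x 0 = 0" "br 0 x = 0"
  using br_scale_right[of x 0 0] br_scale_left[of 0 0 x] by simp_all

lemma br_diff_right: "br z (x - y) = br z x - br z y"
  using br_add_right[of z "x - y" y] by simp

lemma br_diff_left: "br (x - y) z = br x z - br y z"
  using br_add_left[of "x - y" y] by simp

lemma br_commute: "br x y = - br y x"
  using br_self[of "x + y"] by (simp add: br_add_left br_add_right eq_neg_iff_add_eq_0 del: br_self)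
    (simp add: add.commute)

lemma br_derivation: "br x (br y z) = br (br x y) z + br y (br x z)"
  by (simp add: br_br)

section \<open>The Killing form and Engel's theorem\<close>

definition killing :: "'v \<Rightarrow> 'v \<Rightarrow> 'k" where
  "killing x y = trace (\<lambda>v. br x (br y v))"

lemma killing_add_left: "killing (x + y) z = killing x z + killing y z"
  by (simp add: killing_def br_add_left trace_add)

lemma killing_scale_left: "killing (scale c x) z = c * killing x z"
  by (simp add: killing_def br_scale_left trace_scale)

lemma killing_commute: "killing x y = killing y x"
  unfolding killing_def by (intro trace_commute endo_br)

lemma killing_add_right: "killing z (x + y) = killing z x + killing z y"
  by (simp add: killing_commute[of z] killing_add_left)

lemma killing_scale_right: "killing z (scale c x) = c * killing z x"
  by (simp add: killing_commute[of z] killing_scale_left)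

lemma killing_zero [simp]: "killing 0 z = 0" "killing z 0 = 0"
  using killing_scale_left[of 0 0 z] killing_scale_right[of z 0 0] by simp_all

text \<open>After expanding commutators both sides contain the trace of
  \<open>ad x \<circ> ad y \<circ> ad z\<close>, and the remaining terms agree by cyclicity of the
  trace.\<close>

lemma killing_invariant: "killing (br x y) z = killing x (br y z)"
proof -
  have "trace (\<lambda>v. br y (br x (br z v))) = trace (\<lambda>v. br x (br z (br y v)))"
    by (rule trace_commute[OF endo_br endo_compose[OF endo_br endo_br]])
  then show ?thesis by (simp add: killing_def br_br br_diff_right trace_diff)
qed

text \<open>Engel's theorem relative to a pair \<open>W \<subset> V\<close>, which plays the role of
  the quotient of \<open>V\<close> by \<open>W\<close>: the vector found is a common null vector
  there. The induction on \<open>dim N\<close> uses a maximal proper subalgebra \<open>M\<close>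
  twice, on \<open>N\<close> modulo \<open>M\<close> and on \<open>V\<close> modulo
  \<open>W\<close>.\<close>

lemma engel:
  assumes "subspace N" "N \<subseteq> space" "\<And>x y. x \<in> N \<Longrightarrow> y \<in> N \<Longrightarrow> br x y \<in> N"
    and "\<And>x v. x \<in> N \<Longrightarrow> v \<in> space \<Longrightarrow> \<exists>n. (br x ^^ n) v = 0"
    and "V \<subseteq> space" "\<And>x v. x \<in> N \<Longrightarrow> v \<in> V \<Longrightarrow> br x v \<in> V"
    and "subspace W" "W \<subset> V" "\<And>x w. x \<in> N \<Longrightarrow> w \<in> W \<Longrightarrow> br x w \<in> W"
  shows "\<exists>v\<in>V - W. \<forall>x\<in>N. br x v \<in> W"
  using assms
proof (induction "dim N" arbitrary: N V W rule: less_induct)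
  case less
  note N = less.prems(1-4) and V = less.prems(5,6) and W = less.prems(7-9)
  have span_basis: "U \<subseteq> span (e ` I)" if "U \<subseteq> space" for U
    using that by (simp add: space_def)
  show ?case
  proof (cases "N = {0}")
    case True
    then show ?thesis using W(1,2) subspace_0 by auto
  next
    case False
    define P where "P M \<longleftrightarrow> subspace M \<and> M \<subset> N \<and> (\<forall>x\<in>M. \<forall>y\<in>M. br x y \<in> M)" for M
    have P0: "P {0}" using False N(1) subspace_0 by (auto simp: P_def)
    have P_sub: "subspace M \<and> M \<subseteq> span (e ` I)" if "P M" for M
      using that N(2) span_basis[of M] by (auto simp: P_def)
    obtain M where M: "P M" and M_max: "\<forall>M'. P M' \<longrightarrow> M \<subseteq> M' \<longrightarrow> M' = M"
      by (rule maximal_subspace_exists[where P = P, OF finite_basis P0 P_sub]) (assumption | rule that)+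
    have subM: "subspace M" "M \<subset> N" and clM: "\<And>x y. x \<in> M \<Longrightarrow> y \<in> M \<Longrightarrow> br x y \<in> M"
      using M by (auto simp: P_def)
    have dim: "dim M < dim N"
      using subM span_basis[OF N(2)] by (intro dim_strict_mono[OF finite_basis])
    have nilM: "\<And>x v. x \<in> M \<Longrightarrow> v \<in> space \<Longrightarrow> \<exists>n. (br x ^^ n) v = 0"
      using subM N(4) by blast
    have Mspace: "M \<subseteq> space" using subM N(2) by blast
    \<comment> \<open>The induction hypothesis for \<open>M\<close> acting on \<open>N\<close>
      modulo \<open>M\<close> yields an element outside \<open>M\<close> that normalizes
      \<open>M\<close>.\<close>
    obtain x where x: "x \<in> N" "x \<notin> M" "\<And>m. m \<in> M \<Longrightarrow> br m x \<in> M"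
      using less.hyps[OF dim subM(1) Mspace clM nilM N(2) _ subM(1) subM(2) clM] N(3) subM(2)
      by blast
    \<comment> \<open>Adding the line through \<open>x\<close> gives a subalgebra strictly above
      \<open>M\<close>, so by maximality it is all of \<open>N\<close>.\<close>
    define M' where "M' = {m + scale c x | m c. m \<in> M}"
    have "M' = {m + z | m z. m \<in> M \<and> z \<in> span {x}}"
      unfolding M'_def span_singleton by auto
    then have "subspace M'" using subspace_sums[OF subM(1) subspace_span, of "{x}"] by simp
    moreover have "M' \<subseteq> N"
      using subM(2) x(1) N(1) subspace_add subspace_scale unfolding M'_def by blast
    moreover have MM': "M \<subseteq> M'"
    proof
      fix m assume "m \<in> M"
      moreover have "m = m + scale 0 x" by simp
      ultimately show "m \<in> M'" unfolding M'_def by blast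
    qed
    moreover have "br a b \<in> M'" if a: "a \<in> M'" and b: "b \<in> M'" for a b
    proof -
      obtain m c n d where ab: "a = m + scale c x" "b = n + scale d x" "m \<in> M" "n \<in> M"
        using a b unfolding M'_def by blast
      have "br a b = br m n + scale d (br m x) + scale c (br x n)"
        by (simp add: ab br_add_left br_add_right br_scale_left br_scale_right scale_right_distrib
            add.assoc add.left_commute)
      moreover have "br x n \<in> M" using x(3)[OF ab(4)] br_commute[of x n] subspace_neg subM(1) by simp
      ultimately have "br a b \<in> M" 
        using x(3) clM ab subM(1) subspace_add subspace_scale by metis
      then show ?thesis using MM' by blast
    qed
    moreover have "x \<in> M'" unfolding M'_def using subspace_0[OF subM(1)] by (auto intro!: exI[of _ 0] exI[of _ 1])
    ultimately have M'_eq: "M' = N" using M_max[rule_format, of M'] x(2) unfolding P_def by blast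
    \<comment> \<open>These are the vectors that \<open>M\<close> kills modulo \<open>W\<close>. The
      induction hypothesis finds one outside \<open>W\<close>, and \<open>x\<close> preserves
      \<open>U\<close> because it normalizes \<open>M\<close>.\<close>
    define U where "U = {v \<in> V. \<forall>m\<in>M. br m v \<in> W}"
    have WM: "\<And>y w. y \<in> M \<Longrightarrow> w \<in> W \<Longrightarrow> br y w \<in> W" and VM: "\<And>y w. y \<in> M \<Longrightarrow> w \<in> V \<Longrightarrow> br y w \<in> V"
      using W(3) V(2) subM(2) by blast+
    obtain v where v: "v \<in> U" "v \<notin> W"
      using less.hyps[OF dim subM(1) Mspace clM nilM V(1) VM W(1,2) WM] unfolding U_def by blast
    have xU: "br x u \<in> U" if u: "u \<in> U" for u
    proof -
      have "br m (br x u) \<in> W" if m: "m \<in> M" for m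
      proof -
        have "br (br m x) u \<in> W" "br x (br m u) \<in> W"
          using u m x W(3) unfolding U_def by blast+
        then show ?thesis using br_derivation[of m x u] subspace_add[OF W(1)] by simp
      qed
      then show ?thesis using u x(1) V(2) unfolding U_def by blast
    qed
    have pow: "(br x ^^ n) v \<in> U" for n
      by (induction n) (simp_all add: v(1) xU)
    have "v \<in> space" using v(1) V(1) unfolding U_def by blast
    then obtain n where "(br x ^^ n) v = 0" using N(4) x(1) by blast
    then have ex: "(br x ^^ n) v \<in> W" using subspace_0[OF W(1)] by simp
    \<comment> \<open>Since \<open>v\<close> is outside \<open>W\<close>, the least such exponent is
      positive. The power just before it is still outside \<open>W\<close> but is sent into
      \<open>W\<close> by \<open>x\<close>, and by \<open>M\<close> as it lies in
      \<open>U\<close>.\<close>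
    define l where "l = (LEAST n. (br x ^^ n) v \<in> W)"
    have l: "(br x ^^ l) v \<in> W" unfolding l_def using ex by (rule LeastI)
    have "l \<noteq> 0" using l v(2) by (cases l) auto
    then obtain k where k: "l = Suc k" by (cases l) auto
    have "(br x ^^ k) v \<notin> W" using not_less_Least[of k "\<lambda>n. (br x ^^ n) v \<in> W"] k l_def by simp
    moreover have "br y ((br x ^^ k) v) \<in> W" if "y \<in> N" for y
    proof -
      have "y \<in> M'" using that M'_eq by simp
      then obtain m c where y: "y = m + scale c x" "m \<in> M" unfolding M'_def by blast
      have "br x ((br x ^^ k) v) \<in> W" using l k by simp
      then show ?thesis
        using y pow[of k] subspace_add[OF W(1)] subspace_scale[OF W(1)]
        unfolding U_def by (simp add: br_add_left br_scale_left)
    qed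
    ultimately show ?thesis using pow[of k] unfolding U_def by blast
  qed
qed

text \<open>Repeated use of \<open>engel\<close> produces a flag of \<open>space\<close> that
  \<open>K\<close> preserves and \<open>N\<close> lowers by one step. Hence
  \<open>ad c \<circ> ad y\<close> also lowers it, so it is nilpotent and has trace zero.\<close>

lemma killing_zero_of_nilpotent_ideal:
  assumes K: "K \<subseteq> space"
    and N: "subspace N" "N \<subseteq> K" "\<And>x y. x \<in> K \<Longrightarrow> y \<in> N \<Longrightarrow> br x y \<in> N"
    and nil: "\<And>x v. x \<in> N \<Longrightarrow> v \<in> space \<Longrightarrow> \<exists>n. (br x ^^ n) v = 0"
    and c: "c \<in> N" and y: "y \<in> K"
  shows "killing c y = 0"
proof -
  define V where "V = rec_nat {0} (\<lambda>_ W. {v \<in> space. \<forall>x\<in>N. br x v \<in> W})"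
  have V_0: "V 0 = {0}" and V_Suc: "V (Suc m) = {v \<in> space. \<forall>x\<in>N. br x v \<in> V m}" for m
    by (simp_all add: V_def)
  have sub: "subspace (V m)" for m
  proof (induction m)
    case (Suc m)
    then show ?case
      unfolding V_Suc subspace_def using subspace_space[unfolded subspace_def]
      by (auto simp: br_add_right br_scale_right)
  qed (simp add: V_0)
  have Vspace: "V m \<subseteq> space" for m
    by (cases m) (auto simp: V_0 V_Suc subspace_0[OF subspace_space])
  have stable: "br x v \<in> V m" if "x \<in> K" "v \<in> V m" for x v m
    using that
  proof (induction m arbitrary: v)
    case (Suc m)
    \<comment> \<open>As \<open>N\<close> is an ideal of \<open>K\<close>, moving \<open>n\<close>
      past \<open>x\<close> costs only the commutator term with
      \<open>br x n \<in> N\<close>.\<close>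
    have "br n (br x v) \<in> V m" if n: "n \<in> N" for n
    proof -
      have "br x (br n v) \<in> V m" using Suc n unfolding V_Suc by blast
      moreover have "br (br x n) v \<in> V m" using Suc.prems N(3) n unfolding V_Suc by blast
      ultimately have "br x (br n v) - br (br x n) v \<in> V m" using subspace_diff[OF sub] by blast
      then show ?thesis by (simp add: br_br)
    qed
    then show ?case unfolding V_Suc by (simp add: br_in_space)
  qed (simp add: V_0)
  have mono: "V m \<subseteq> V (Suc m)" for m
    using stable N(2) Vspace unfolding V_Suc by blast
  have grow: "V m \<noteq> space \<Longrightarrow> V m \<subset> V (Suc m)" for m
  proof -
    assume ne: "V m \<noteq> space"
    have "\<exists>v\<in>space - V m. \<forall>x\<in>N. br x v \<in> V m"
      using N nil stable ne Vspace K sub br_in_space by (intro engel) blast+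
    then show ?thesis using mono unfolding V_Suc by blast
  qed
  have "V m = space \<or> m \<le> dim (V m)" for m
  proof (induction m)
    case (Suc m)
    show ?case
    proof (cases "V m = space")
      case True
      then show ?thesis using mono[of m] Vspace[of "Suc m"] by blast
    next
      case False
      then have "dim (V m) < dim (V (Suc m))"
        using sub grow Vspace by (intro dim_strict_mono[OF finite_basis]) (auto simp: space_def)
      then show ?thesis using Suc False by simp
    qed
  qed simp
  moreover have "dim (V m) \<le> card (e ` I)" for m
    using Vspace unfolding space_def by (intro dim_le_card finite_basis)
  ultimately obtain m where m: "V m = space" by (metis not_less_eq_eq)
  let ?f = "\<lambda>v. br c (br y v)"
  have step: "?f v \<in> V j" if "v \<in> V (Suc j)" for v j
    using stable[OF y that] c unfolding V_Suc by blast
  have "(?f ^^ j) v = 0" if "v \<in> V j" for v j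
    using that
  proof (induction j arbitrary: v)
    case (Suc j)
    then show ?case using Suc.IH[OF step[OF Suc.prems]] by (simp only: funpow_Suc_right comp_apply)
  qed (simp add: V_0)
  then have "trace ?f = 0"
    using m by (intro trace_nilpotent[where n = m, OF endo_compose[OF endo_br endo_br]]) simp
  then show ?thesis by (simp add: killing_def)
qed

end

section \<open>Generalized eigenspaces\<close>

context coordinate_space
begin

definition shift :: "('v \<Rightarrow> 'v) \<Rightarrow> 'k \<Rightarrow> 'v \<Rightarrow> 'v" where
  "shift f l v = f v - scale l v"

definition gen_eigenspace :: "('v \<Rightarrow> 'v) \<Rightarrow> 'k \<Rightarrow> 'v set" where
  "gen_eigenspace f l = {v \<in> space. \<exists>n. (shift f l ^^ n) v = 0}"

context
  fixes f assumes f: "endo f"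
begin

lemma shift_linear: "Vector_Spaces.linear scale scale (shift f l)"
  unfolding Vector_Spaces.linear_iff shift_def
  by (simp add: vector_space_axioms endo_add[OF f] endo_scale[OF f] scale_right_distrib
      scale_right_diff_distrib mult.commute)

lemma shift_in_space: "v \<in> space \<Longrightarrow> shift f l v \<in> space"
  unfolding shift_def using endo_in_space[OF f] subspace_space by (intro subspace_diff subspace_scale)

lemma shift_add: "shift f l (x + y) = shift f l x + shift f l y"
  using shift_linear[of l] by (simp add: Vector_Spaces.linear_iff)

lemma shift_scale: "shift f l (scale c x) = scale c (shift f l x)"
  using shift_linear[of l] by (simp add: Vector_Spaces.linear_iff)

lemma shift_diff: "shift f l (x - y) = shift f l x - shift f l y"
  using shift_add[of l "x - y" y] by simp

lemma shift_pow_scale: "(shift f l ^^ n) (scale c x) = scale c ((shift f l ^^ n) x)"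
  by (induction n) (simp_all add: shift_scale)

lemma shift_pow_add: "(shift f l ^^ n) (x + y) = (shift f l ^^ n) x + (shift f l ^^ n) y"
  by (induction n) (simp_all add: shift_add)

lemma shift_pow_zero: "(shift f l ^^ n) 0 = 0"
  using shift_pow_scale[of n l 0 0] by simp

lemma shift_pow_sum: "(shift f l ^^ n) (\<Sum>a\<in>A. g a) = (\<Sum>a\<in>A. (shift f l ^^ n) (g a))"
  by (induction A rule: infinite_finite_induct) (simp_all add: shift_pow_zero shift_pow_add)

lemma shift_shift: "shift f l (shift f m v) = shift f m (shift f l v)"
  unfolding shift_def
  by (simp add: endo_diff[OF f] endo_scale[OF f] scale_right_diff_distrib scale_left_commute)

lemma shift_pow_shift: "(shift f l ^^ n) (shift f m v) = shift f m ((shift f l ^^ n) v)"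
  by (induction n) (simp_all add: shift_shift)

lemma subspace_gen_eigenspace: "subspace (gen_eigenspace f l)"
proof -
  have "gen_eigenspace f l = space \<inter> {v. \<exists>n. (shift f l ^^ n) v = 0}"
    by (auto simp: gen_eigenspace_def)
  then show ?thesis
    using subspace_inter[OF subspace_space subspace_locally_nilpotent[OF shift_linear]] by simp
qed

lemma gen_eigenspace_in_space: "v \<in> gen_eigenspace f l \<Longrightarrow> v \<in> space"
  by (simp add: gen_eigenspace_def)

lemma shift_in_gen_eigenspace: "v \<in> gen_eigenspace f m \<Longrightarrow> shift f l v \<in> gen_eigenspace f m"
proof -
  assume "v \<in> gen_eigenspace f m"
  then obtain n where "v \<in> space" "(shift f m ^^ n) v = 0" by (auto simp: gen_eigenspace_def)
  then have "(shift f m ^^ n) (shift f l v) = 0" "shift f l v \<in> space"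
    using shift_scale[of l 0 0] by (simp_all add: shift_pow_shift shift_in_space)
  then show "shift f l v \<in> gen_eigenspace f m" by (auto simp: gen_eigenspace_def)
qed

lemma shift_pow_in_gen_eigenspace:
  "v \<in> gen_eigenspace f m \<Longrightarrow> (shift f l ^^ n) v \<in> gen_eigenspace f m"
  by (induction n) (simp_all add: shift_in_gen_eigenspace)

lemma in_gen_eigenspace_of_shift:
  assumes "v \<in> space" "shift f l v \<in> gen_eigenspace f l"
  shows "v \<in> gen_eigenspace f l"
proof -
  obtain n where "(shift f l ^^ n) (shift f l v) = 0" using assms(2) by (auto simp: gen_eigenspace_def)
  then have "(shift f l ^^ Suc n) v = 0" by (simp only: funpow_Suc_right comp_apply)
  then show ?thesis using assms(1) unfolding gen_eigenspace_def by blast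
qed

lemma shift_eq: "shift f l v = shift f m v + scale (m - l) v"
  by (simp add: shift_def scale_left_diff_distrib)

text \<open>On this subspace \<open>shift f l\<close> is a locally nilpotent map plus the nonzero
  scalar \<open>m - l\<close>. The induction on the nilpotency exponent builds a preimage
  explicitly.\<close>

lemma shift_onto_gen_eigenspace:
  assumes "l \<noteq> m" "w \<in> gen_eigenspace f m"
  shows "\<exists>u\<in>gen_eigenspace f m. shift f l u = w"
proof -
  obtain n where "(shift f m ^^ n) w = 0" using assms(2) by (auto simp: gen_eigenspace_def)
  then show ?thesis using assms(2)
  proof (induction n arbitrary: w)
    case 0
    then have "w = 0" by simp
    then show ?case
      using shift_scale[of l 0 0] subspace_0[OF subspace_gen_eigenspace] by auto
  next
    case (Suc n)
    have "(shift f m ^^ n) (shift f m w) = 0"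
      using Suc.prems(1) by (simp only: funpow_Suc_right comp_apply)
    \<comment> \<open>The vector \<open>u\<close> absorbs the nilpotent part:
      \<open>shift f l\<close> maps \<open>w - u\<close> to \<open>(m - l) w\<close>, and it remains
      to divide.\<close>
    then obtain u where u: "u \<in> gen_eigenspace f m" "shift f l u = shift f m w"
      using Suc.IH shift_in_gen_eigenspace[OF Suc.prems(2)] by blast
    have "shift f l (w - u) = scale (m - l) w"
      using u(2) shift_eq[of l w m] by (simp add: shift_diff)
    then have "shift f l (scale (inverse (m - l)) (w - u)) = w"
      using assms(1) by (simp add: shift_scale)
    moreover have "scale (inverse (m - l)) (w - u) \<in> gen_eigenspace f m"
      using Suc.prems(2) u(1) subspace_gen_eigenspace by (intro subspace_scale subspace_diff)
    ultimately show ?case by blast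
  qed
qed

text \<open>A vector killed by \<open>shift f l\<close> is multiplied by \<open>l - m\<close> under
  \<open>shift f m\<close>, and no power of this nonzero scalar vanishes.\<close>

lemma shift_injective_on_gen_eigenspace:
  assumes "l \<noteq> m" "v \<in> gen_eigenspace f m" "shift f l v = 0"
  shows "v = 0"
proof -
  obtain n where n: "(shift f m ^^ n) v = 0" using assms(2) by (auto simp: gen_eigenspace_def)
  have "shift f m v = scale (l - m) v" using assms(3) shift_eq[of m v l] by simp
  then have "(shift f m ^^ n) v = scale ((l - m) ^ n) v" for n
    by (induction n) (simp_all add: shift_scale mult.commute)
  then show ?thesis using n assms(1) by simp
qed

lemma shift_pow_injective_on_gen_eigenspace:
  assumes "l \<noteq> m" "v \<in> gen_eigenspace f m" "(shift f l ^^ n) v = 0"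
  shows "v = 0"
  using assms(3)
proof (induction n)
  case (Suc n)
  then show ?case
    using shift_injective_on_gen_eigenspace[OF assms(1) shift_pow_in_gen_eigenspace[OF assms(2)]]
    by simp
qed simp

text \<open>A power of \<open>shift f m\<close> that kills \<open>v m\<close> keeps the other terms
  in their own generalized eigenspaces. The induction hypothesis makes their images zero, and the
  power is injective there.\<close>

lemma gen_eigenspaces_independent:
  assumes "finite A" "\<And>l. l \<in> A \<Longrightarrow> v l \<in> gen_eigenspace f l" "(\<Sum>l\<in>A. v l) = 0" "l \<in> A"
  shows "v l = 0"
  using assms
proof (induction A arbitrary: v l rule: finite_induct)
  case (insert m A)
  obtain n where n: "(shift f m ^^ n) (v m) = 0"
    using insert.prems(1)[of m] by (auto simp: gen_eigenspace_def)
  have "(\<Sum>l\<in>A. (shift f m ^^ n) (v l)) = (shift f m ^^ n) (v m + (\<Sum>l\<in>A. v l))"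
    by (simp add: shift_pow_add shift_pow_sum n)
  also have "\<dots> = 0" using insert by (simp add: shift_pow_zero)
  finally have *: "(shift f m ^^ n) (v k) = 0" if "k \<in> A" for k
    using insert.IH[of "\<lambda>l. (shift f m ^^ n) (v l)"] insert.prems(1) that
      shift_pow_in_gen_eigenspace by blast
  have A: "v k = 0" if "k \<in> A" for k
  proof -
    have "m \<noteq> k" using that insert.hyps(2) by blast
    then show ?thesis
      using shift_pow_injective_on_gen_eigenspace[OF _ _ *[OF that]] insert.prems(1) that by blast
  qed
  then have "v m = 0" using insert by simp
  then show ?case using A insert.prems(3) by blast
qed simp

section \<open>Polynomials in an endomorphism\<close>

definition poly_apply :: "'k poly \<Rightarrow> 'v \<Rightarrow> 'v" where
  "poly_apply p v = (\<Sum>i\<le>degree p. scale (coeff p i) ((f ^^ i) v))"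

lemma poly_apply_eq:
  assumes "degree p \<le> n"
  shows "poly_apply p v = (\<Sum>i\<le>n. scale (coeff p i) ((f ^^ i) v))"
  unfolding poly_apply_def using assms
  by (intro sum.mono_neutral_left) (auto simp: coeff_eq_0)

lemma poly_apply_linear_factor: "poly_apply ([:- l, 1:] * q) v = shift f l (poly_apply q v)"
proof -
  let ?n = "degree q"
  have f_sum: "f (poly_apply q v) = (\<Sum>i\<le>?n. scale (coeff q i) ((f ^^ Suc i) v))"
    by (simp add: poly_apply_def endo_sum[OF f] endo_scale[OF f])
  have deg: "degree ([:- l, 1:] * q) \<le> Suc ?n"
    by (rule order.trans[OF degree_mult_le]) simp
  \<comment> \<open>The polynomial \<open>pCons 0 q\<close> is \<open>q\<close> times the variable;
    its coefficients are those of \<open>q\<close> moved up by one, which gives one further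
    application of \<open>f\<close>.\<close>
  have "poly_apply ([:- l, 1:] * q) v
      = (\<Sum>i\<le>Suc ?n. scale (coeff (pCons 0 q) i) ((f ^^ i) v) - scale l (scale (coeff q i) ((f ^^ i) v)))"
    unfolding poly_apply_eq[OF deg]
    by (intro sum.cong) (simp_all add: scale_left_diff_distrib[symmetric] del: sum.atMost_Suc)
  also have "\<dots> = (\<Sum>i\<le>Suc ?n. scale (coeff (pCons 0 q) i) ((f ^^ i) v)) - scale l (poly_apply q v)"
    by (subst poly_apply_eq[of q "Suc ?n"])
      (simp_all add: sum_subtractf scale_sum_right del: sum.atMost_Suc)
  also have "(\<Sum>i\<le>Suc ?n. scale (coeff (pCons 0 q) i) ((f ^^ i) v)) = f (poly_apply q v)"
    unfolding f_sum by (subst sum.atMost_Suc_shift) simp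
  finally show ?thesis by (simp add: shift_def)
qed

lemma annihilating_poly_exists:
  assumes v: "v \<in> space"
  obtains p where "p \<noteq> 0" "poly_apply p v = 0"
\<comment> \<open>Dependence is a property of sets, in which equal iterates collapse. A repetition
  is therefore treated apart and gives a difference of two monomials.\<close>
proof (cases "inj_on (\<lambda>i. (f ^^ i) v) {..card (e ` I)}")
  case False
  then obtain i j where ij: "i < j" "(f ^^ i) v = (f ^^ j) v"
    by (auto simp: inj_on_def) (metis linorder_neqE_nat)
  define p where "p = monom 1 j - (monom 1 i :: 'k poly)"
  have "coeff p j = 1" using ij(1) by (simp add: p_def)
  then have "p \<noteq> 0" by auto
  have "degree p \<le> j"
    unfolding p_def using ij(1) by (intro degree_diff_le order.trans[OF degree_monom_le]) auto
  then have "poly_apply p v = (\<Sum>k\<le>j. scale (coeff p k) ((f ^^ k) v))"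
    by (rule poly_apply_eq)
  also have "\<dots> = (\<Sum>k\<le>j. (if k = j then (f ^^ j) v else 0) - (if k = i then (f ^^ i) v else 0))"
    unfolding p_def using ij(1) by (intro sum.cong) auto
  finally have "poly_apply p v = 0" using ij by (simp add: sum_subtractf)
  then show thesis using that \<open>p \<noteq> 0\<close> by blast
next
  case True
  let ?g = "\<lambda>i. (f ^^ i) v" and ?n = "card (e ` I)"
  have mem: "?g i \<in> space" for i
    using v endo_in_space[OF f] by (cases i) auto
  have "dependent (?g ` {..?n})"
  proof (rule ccontr)
    assume "\<not> dependent (?g ` {..?n})"
    then have "card (?g ` {..?n}) \<le> ?n"
      using independent_span_bound[OF finite_basis, of "?g ` {..?n}"] mem by (auto simp: space_def)
    then show False using card_image[OF True] by simp
  qed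
  then obtain u w where u: "w \<in> ?g ` {..?n}" "u w \<noteq> 0" "(\<Sum>w\<in>?g ` {..?n}. scale (u w) w) = 0"
    by (auto simp: dependent_finite)
  then obtain k where k: "k \<le> ?n" "u (?g k) \<noteq> 0" by blast
  define p where "p = Poly (map (\<lambda>i. u (?g i)) [0..<Suc ?n])"
  have cp: "coeff p i = (if i \<le> ?n then u (?g i) else 0)" for i
    by (auto simp: p_def nth_default_def simp del: upt_Suc)
  have "degree p \<le> ?n" by (rule degree_le) (simp add: cp)
  then have "poly_apply p v = (\<Sum>i\<le>?n. scale (u (?g i)) (?g i))"
    by (simp add: poly_apply_eq cp)
  also have "\<dots> = 0" using u(3) by (simp add: sum.reindex[OF True])
  finally have "poly_apply p v = 0" .
  moreover have "p \<noteq> 0" using k cp[of k] by auto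
  ultimately show thesis using that by blast
qed

end

end

section \<open>Spanning by generalized eigenspaces over the complex numbers\<close>

locale complex_coordinate_space = coordinate_space scale I e coord
  for scale :: "complex \<Rightarrow> 'v::ab_group_add \<Rightarrow> 'v" and I :: "'i set" and e coord
begin

text \<open>A polynomial annihilating \<open>v\<close> splits into linear factors, and the factors
  can be stripped off one at a time: if \<open>shift f l\<close> sends a vector of
  \<open>space\<close> into the span, the vector is in the span already
  (\<open>pull\<close>).\<close>

lemma gen_eigenspaces_span:
  assumes f: "endo f"
  shows "span (\<Union>l. gen_eigenspace f l) = space"
proof
  let ?T = "span (\<Union>l. gen_eigenspace f l)"
  show "?T \<subseteq> space"
    using gen_eigenspace_in_space[OF f] subspace_space by (intro span_minimal) auto
  have pull: "v \<in> ?T" if v: "v \<in> space" "shift f l v \<in> ?T" for v l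
  proof -
    \<comment> \<open>\<open>R\<close> contains the generalized eigenspace of \<open>l\<close> by
      definition and the others because \<open>shift f l\<close> is onto there. Thus
      \<open>shift f l v\<close> agrees with some \<open>shift f l u\<close>, \<open>u\<close> in
      the span, up to a vector of \<open>gen_eigenspace f l\<close>, to which \<open>v - u\<close>
      then belongs.\<close>
    define R where "R = {w. \<exists>u\<in>?T. \<exists>z\<in>gen_eigenspace f l. w = shift f l u + z}"
    have "subspace R"
    proof (rule subspaceI)
      show "0 \<in> R" unfolding R_def
        using shift_scale[OF f, of l 0 0] subspace_0[OF subspace_gen_eigenspace[OF f]] span_zero
        by (auto intro!: bexI[of _ 0])
    next
      fix x y assume "x \<in> R" "y \<in> R"
      then obtain u z u' z' where "u \<in> ?T" "z \<in> gen_eigenspace f l" "x = shift f l u + z"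
        "u' \<in> ?T" "z' \<in> gen_eigenspace f l" "y = shift f l u' + z'" unfolding R_def by blast
      then have "u + u' \<in> ?T" "z + z' \<in> gen_eigenspace f l"
        "x + y = shift f l (u + u') + (z + z')"
        using span_add subspace_add[OF subspace_gen_eigenspace[OF f]]
        by (simp_all add: shift_add[OF f])
      then show "x + y \<in> R" unfolding R_def by blast
    next
      fix c x assume "x \<in> R"
      then obtain u z where "u \<in> ?T" "z \<in> gen_eigenspace f l" "x = shift f l u + z"
        unfolding R_def by blast
      then have "scale c u \<in> ?T" "scale c z \<in> gen_eigenspace f l"
        "scale c x = shift f l (scale c u) + scale c z"
        using span_scale subspace_scale[OF subspace_gen_eigenspace[OF f]]
        by (simp_all add: shift_scale[OF f] scale_right_distrib)
      then show "scale c x \<in> R" unfolding R_def by blast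
    qed
    moreover have "gen_eigenspace f m \<subseteq> R" for m
    proof
      fix w assume w: "w \<in> gen_eigenspace f m"
      show "w \<in> R"
      proof (cases "m = l")
        case True
        have "w = shift f l 0 + w" using shift_scale[OF f, of l 0 0] by simp
        then show ?thesis using True w span_zero unfolding R_def by blast
      next
        case False
        then obtain u where u: "u \<in> gen_eigenspace f m" "shift f l u = w"
          using shift_onto_gen_eigenspace[OF f not_sym[OF False] w] by blast
        then have "w = shift f l u + 0" by simp
        moreover have "u \<in> ?T" by (rule span_base) (use u in blast)
        moreover have "0 \<in> gen_eigenspace f l"
          by (rule subspace_0[OF subspace_gen_eigenspace[OF f]])
        ultimately show ?thesis unfolding R_def by blast
      qed
    qed
    ultimately have "?T \<subseteq> R" by (intro span_minimal) auto
    then obtain u z where u: "u \<in> ?T" "z \<in> gen_eigenspace f l" "shift f l v = shift f l u + z"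
      using v(2) unfolding R_def by blast
    have "u \<in> space" using u(1) \<open>?T \<subseteq> space\<close> by blast
    then have vu: "v - u \<in> space" using v(1) subspace_diff[OF subspace_space] by blast
    have "shift f l (v - u) = z" using u(3) by (simp add: shift_diff[OF f])
    then have "v - u \<in> gen_eigenspace f l"
      using u(2) by (intro in_gen_eigenspace_of_shift[OF f vu]) simp
    then have "v - u \<in> ?T" by (intro span_base) blast
    then have "(v - u) + u \<in> ?T" using u(1) by (rule span_add)
    then show ?thesis by simp
  qed
  show "space \<subseteq> ?T"
  proof
    fix v assume v: "v \<in> space"
    have pspace: "poly_apply f p v \<in> space" for p
    proof -
      have "(f ^^ i) v \<in> space" for i using v endo_in_space[OF f] by (cases i) auto
      then show ?thesis unfolding poly_apply_def[OF f]
        by (intro subspace_sum[OF subspace_space] subspace_scale[OF subspace_space])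
    qed
    \<comment> \<open>For the induction on the degree, the value of the polynomial is only asked to
      lie in the span rather than to vanish.\<close>
    have "\<forall>p. p \<noteq> 0 \<longrightarrow> degree p = n \<longrightarrow> poly_apply f p v \<in> ?T \<longrightarrow> v \<in> ?T" for n
    proof (induction n)
      case 0
      show ?case
      proof (intro allI impI)
        fix p :: "complex poly" assume p: "p \<noteq> 0" "degree p = 0" "poly_apply f p v \<in> ?T"
        obtain c where c: "p = [:c:]"
          using p(2) by (rule degree_eq_zeroE)
        then have "c \<noteq> 0" using p(1) by simp
        have "scale c v \<in> ?T" using p(3) c by (simp add: poly_apply_def[OF f])
        then have "scale (inverse c) (scale c v) \<in> ?T" by (rule span_scale)
        then show "v \<in> ?T" using \<open>c \<noteq> 0\<close> by simp
      qed
    next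
      case (Suc n)
      show ?case
      proof (intro allI impI)
        fix p :: "complex poly" assume p: "p \<noteq> 0" "degree p = Suc n" "poly_apply f p v \<in> ?T"
        have "\<not> constant (poly p)" using p(2) by (simp add: constant_degree)
        then obtain z where "poly p z = 0" using fundamental_theorem_of_algebra by blast
        then obtain q where q: "p = [:- z, 1:] * q" by (auto simp: poly_eq_0_iff_dvd)
        then have "q \<noteq> 0" using p(1) by auto
        moreover have "degree q = n" using p(2) degree_mult_eq[of "[:- z, 1:]" q] q \<open>q \<noteq> 0\<close> by simp
        moreover have "shift f z (poly_apply f q v) \<in> ?T"
          using p(3) unfolding q poly_apply_linear_factor[OF f] .
        then have "poly_apply f q v \<in> ?T" by (rule pull[OF pspace])
        ultimately show "v \<in> ?T" using Suc.IH by simp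
      qed
    qed
    moreover obtain p where "p \<noteq> 0" "poly_apply f p v = 0"
      by (rule annihilating_poly_exists[OF f v])
    moreover have "0 \<in> ?T" by (rule span_zero)
    ultimately show "v \<in> ?T" by simp
  qed
qed

end

section \<open>Nilpotency over the complex numbers\<close>

context coordinate_space
begin

text \<open>By independence of the generalized eigenspaces, the expansion of \<open>v \<in> gen_eigenspace f l\<close>
  involves only the basis vectors from \<open>gen_eigenspace f l\<close>.\<close>

lemma scalar_on_gen_eigenspace:
  assumes f: "endo f" and C: "finite C" "independent C" "span C = space"
    and eig: "\<And>c. c \<in> C \<Longrightarrow> c \<in> gen_eigenspace f (ev c)"
    and g: "Vector_Spaces.linear scale scale g" "\<And>c. c \<in> C \<Longrightarrow> g c = scale (h (ev c)) c"
    and v: "v \<in> gen_eigenspace f l"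
  shows "g v = scale (h l) v"
proof -
  interpret g: Vector_Spaces.linear scale scale g by fact
  define r where "r = representation C v"
  have v_sum: "(\<Sum>c\<in>C. scale (r c) c) = v"
    unfolding r_def using C gen_eigenspace_in_space[OF f v]
    by (intro sum_representation_eq) auto
  define w where "w m = (\<Sum>c\<in>{c \<in> C. ev c = m}. scale (r c) c)" for m
  \<comment> \<open>No basis vector need have the eigenvalue \<open>l\<close>, so \<open>l\<close>
    is inserted to allow comparison of the components at \<open>l\<close>.\<close>
  define A where "A = insert l (ev ` C)"
  have finA: "finite A" using C(1) by (simp add: A_def)
  have w_in: "w m \<in> gen_eigenspace f m" for m
    unfolding w_def using eig subspace_gen_eigenspace[OF f]
    by (intro subspace_sum subspace_scale) auto
  have "(\<Sum>m\<in>A. w m) = v"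
    unfolding w_def using sum.group[OF C(1) finA, of ev "\<lambda>c. scale (r c) c"] v_sum
    by (auto simp: A_def)
  moreover have "(\<Sum>m\<in>A. if m = l then v else 0) = v" using finA by (simp add: A_def)
  ultimately have sum0: "(\<Sum>m\<in>A. w m - (if m = l then v else 0)) = 0" by (simp add: sum_subtractf)
  have mem: "w m - (if m = l then v else 0) \<in> gen_eigenspace f m" for m
    using w_in v subspace_diff[OF subspace_gen_eigenspace[OF f]] by auto
  have "l \<in> A" by (simp add: A_def)
  with mem sum0 have "w l - (if l = l then v else 0) = 0"
    by (rule gen_eigenspaces_independent[OF f finA])
  then have wl: "w l = v" by simp
  have "g v = (\<Sum>c\<in>{c \<in> C. ev c = l}. scale (r c) (g c))"
    by (subst wl[symmetric]) (simp add: w_def g.sum g.scale)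
  also have "\<dots> = scale (h l) (w l)"
    unfolding w_def scale_sum_right
    by (intro sum.cong refl) (simp add: g(2) scale_left_commute)
  finally show ?thesis using wl by simp
qed

end

locale complex_coordinate_lie_algebra = coordinate_lie_algebra scale I e coord br
  for scale :: "complex \<Rightarrow> 'v::ab_group_add \<Rightarrow> 'v" and I :: "'i set" and e coord br
begin

sublocale complex_coordinate_space scale I e coord
  by unfold_locales

text \<open>By the Leibniz rule \<open>shift (br x) (l + m)\<close> distributes over the bracket as
  \<open>shift (br x) l\<close> on the left factor plus \<open>shift (br x) m\<close> on the right
  one. Each application lowers the sum of the two exponents.\<close>

lemma br_gen_eigenspace:
  assumes y: "y \<in> gen_eigenspace (br x) l" and z: "z \<in> gen_eigenspace (br x) m"
  shows "br y z \<in> gen_eigenspace (br x) (l + m)"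
proof -
  let ?s = "shift (br x)"
  have step: "?s (l + m) (br y z) = br (?s l y) z + br y (?s m z)" for y z
    unfolding shift_def
    by (simp add: br_diff_left br_diff_right br_scale_left br_scale_right scale_left_distrib
        br_derivation[of x y z])
  have zero: "0 \<in> gen_eigenspace (br x) k" for k
    by (rule subspace_0[OF subspace_gen_eigenspace[OF endo_br]])
  have "br y z \<in> gen_eigenspace (br x) (l + m)"
    if "(?s l ^^ a) y = 0" "(?s m ^^ b) z = 0" "a + b = n" for a b n y z
    using that
  proof (induction n arbitrary: a b y z)
    case 0
    then show ?case using zero by simp
  next
    case (Suc n)
    show ?case
    proof (cases "a = 0 \<or> b = 0")
      case True
      then show ?thesis using Suc.prems zero by auto
    next
      case False
      then obtain a' b' where ab: "a = Suc a'" "b = Suc b'" by (metis not0_implies_Suc)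
      have "(?s l ^^ a') (?s l y) = 0" "(?s m ^^ b') (?s m z) = 0"
        using Suc.prems(1,2) unfolding ab by (simp_all only: funpow_Suc_right comp_apply)
      then have "br (?s l y) z \<in> gen_eigenspace (br x) (l + m)"
        "br y (?s m z) \<in> gen_eigenspace (br x) (l + m)"
        using Suc.IH[of a' "?s l y" b z] Suc.IH[of a y b' "?s m z"] Suc.prems ab by auto
      then have "?s (l + m) (br y z) \<in> gen_eigenspace (br x) (l + m)"
        using step subspace_add[OF subspace_gen_eigenspace[OF endo_br]] by simp
      then show ?thesis
        by (rule in_gen_eigenspace_of_shift[OF endo_br br_in_space])
    qed
  qed
  then show ?thesis using y z unfolding gen_eigenspace_def by blast
qed

text \<open>The operator \<open>D\<close> acting on the generalized \<open>l\<close>-eigenspace of \<open>ad x\<close> as the scalar \<open>cnj l\<close>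
  is a derivation, because \<open>cnj\<close> is additive. The hypothesis on \<open>x\<close> gives \<open>trace (ad x \<circ> D) = 0\<close>,
  while this trace is the sum of the squared absolute values of the eigenvalues of \<open>ad x\<close>.\<close>

lemma ad_nilpotent_complex:
  assumes x: "x \<in> span {br a b | a b. a \<in> space \<and> b \<in> space \<and>
      ((\<forall>y\<in>space. killing a y = 0) \<or> br a x = 0)}"
    and v: "v \<in> space"
  shows "\<exists>n. (br x ^^ n) v = 0"
proof -
  let ?f = "br x"
  note f = endo_br[of x]
  obtain C where C: "C \<subseteq> (\<Union>l. gen_eigenspace ?f l)" "independent C"
    "(\<Union>l. gen_eigenspace ?f l) \<subseteq> span C" by (rule maximal_independent_subset)
  have C_span: "span C = space"
  proof
    show "span C \<subseteq> space"
      using C(1) gen_eigenspace_in_space[OF f] subspace_space by (intro span_minimal) auto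
    have "span (\<Union>l. gen_eigenspace ?f l) \<subseteq> span C"
      using C(3) by (intro span_minimal) auto
    then show "space \<subseteq> span C" by (simp add: gen_eigenspaces_span[OF f])
  qed
  have "C \<subseteq> space" using C_span span_superset by blast
  then have finC: "finite C"
    using independent_span_bound[OF finite_basis C(2)] by (simp add: space_def)
  obtain ev where ev: "\<And>c. c \<in> C \<Longrightarrow> c \<in> gen_eigenspace ?f (ev c)"
    using C(1) by (metis UN_E subsetD)
  \<comment> \<open>Any function of the eigenvalue defines an operator diagonal in the eigenvector
    basis. Conjugation yields \<open>D\<close>, and the identity yields the semisimple part
    \<open>S\<close> of \<open>ad x\<close>.\<close>
  have diag: "\<exists>g. endo g \<and> (\<forall>l. \<forall>v\<in>gen_eigenspace ?f l. g v = scale (h l) v)" for h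
  proof -
    obtain g where g: "Vector_Spaces.linear scale scale g" "\<And>c. c \<in> C \<Longrightarrow> g c = scale (h (ev c)) c"
      "range g = span ((\<lambda>c. scale (h (ev c)) c) ` C)"
      by (rule linear_extension[OF C(2), where f = "\<lambda>c. scale (h (ev c)) c"]) blast
    have "span ((\<lambda>c. scale (h (ev c)) c) ` C) \<subseteq> space"
      using \<open>C \<subseteq> space\<close> subspace_space subspace_scale by (intro span_minimal) auto
    then have "endo g" using g(1,3) unfolding endo_def by blast
    then show ?thesis
      using scalar_on_gen_eigenspace[OF f finC C(2) C_span ev g(1,2)] by blast
  qed
  obtain D where D: "endo D" "\<And>l v. v \<in> gen_eigenspace ?f l \<Longrightarrow> D v = scale (cnj l) v"
    using diag[of cnj] by blast
  obtain S where S: "endo S" "\<And>l v. v \<in> gen_eigenspace ?f l \<Longrightarrow> S v = scale l v"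
    using diag[of "\<lambda>l. l"] by blast
  have deriv: "D (br y z) = br (D y) z + br y (D z)" if "y \<in> space" "z \<in> space" for y z
  proof -
    have "D (br c z) = br (D c) z + br c (D z)" if c: "c \<in> C" and z: "z \<in> span C" for c z
      using z
    proof (induction rule: span_induct_alt)
      case (step k d z)
      have "D (br c d) = br (D c) d + br c (D d)"
        using D(2)[OF br_gen_eigenspace[OF ev[OF c] ev[OF step.hyps]]]
          D(2)[OF ev[OF c]] D(2)[OF ev[OF step.hyps]]
        by (simp add: br_scale_left br_scale_right scale_left_distrib)
      then show ?case using step.IH
        by (simp add: br_add_right br_scale_right endo_add[OF D(1)] endo_scale[OF D(1)]
            scale_right_distrib)
    qed (simp add: endo_zero[OF D(1)])
    then have C_z: "D (br c z) = br (D c) z + br c (D z)" if "c \<in> C" for c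
      using that \<open>z \<in> space\<close> C_span by simp
    have "y \<in> span C" using that C_span by simp
    then show ?thesis
      by (induction rule: span_induct_alt)
        (simp_all add: C_z br_add_left br_scale_left endo_zero[OF D(1)] endo_add[OF D(1)]
            endo_scale[OF D(1)] scale_right_distrib)
  qed
  \<comment> \<open>If \<open>a\<close> is in the radical, the derivation property turns the trace
    into \<open>- killing a (D b)\<close>. If \<open>a\<close> commutes with \<open>x\<close>, it
    has eigenvalue 0, so \<open>D a = 0\<close>; then \<open>ad a\<close> commutes with
    \<open>D\<close>, and the commutator has trace zero.\<close>
  have tr_br: "trace (\<lambda>v. br (br a b) (D v)) = 0"
    if a: "a \<in> space" and b: "b \<in> space" and ab: "(\<forall>y\<in>space. killing a y = 0) \<or> br a x = 0" for a b
    using ab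
  proof
    assume a0: "\<forall>y\<in>space. killing a y = 0"
    have "trace (\<lambda>v. br (br a b) (D v)) = trace (\<lambda>v. br a (br b (D v))) - trace (\<lambda>v. br b (br a (D v)))"
      by (simp add: br_br trace_diff)
    also have "trace (\<lambda>v. br b (br a (D v))) = trace (\<lambda>v. br a (D (br b v)))"
      by (rule trace_commute[OF endo_br endo_compose[OF endo_br D(1)]])
    also have "trace (\<lambda>v. br a (br b (D v))) - trace (\<lambda>v. br a (D (br b v)))
        = trace (\<lambda>v. br a (br b (D v)) - br a (D (br b v)))"
      by (rule trace_diff[symmetric])
    also have "\<dots> = trace (\<lambda>v. scale (- 1) (br a (br (D b) v)))"
      by (rule trace_cong) (simp add: deriv b br_add_right)
    also have "\<dots> = - killing a (D b)"
      by (subst trace_scale) (simp add: killing_def)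
    finally show ?thesis using a0 endo_in_space[OF D(1)] by simp
  next
    assume "br a x = 0"
    then have "br x a = 0" using br_commute[of x a] by simp
    then have "(shift ?f 0 ^^ 1) a = 0" by (simp add: shift_def)
    then have "a \<in> gen_eigenspace ?f 0" using a unfolding gen_eigenspace_def by blast
    then have Da: "D a = 0" using D(2) by fastforce
    have "trace (\<lambda>v. br (br a b) (D v)) = trace (\<lambda>v. br a (br b (D v))) - trace (\<lambda>v. br b (br a (D v)))"
      by (simp add: br_br trace_diff)
    also have "trace (\<lambda>v. br a (br b (D v))) = trace (\<lambda>v. br b (D (br a v)))"
      by (rule trace_commute[OF endo_br endo_compose[OF endo_br D(1)]])
    also have "\<dots> = trace (\<lambda>v. br b (br a (D v)))"
      by (rule trace_cong) (simp add: deriv a Da)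
    finally show ?thesis by simp
  qed
  have tr_zero: "trace (\<lambda>v. br u (D v)) = 0"
    if "u \<in> span {br a b | a b. a \<in> space \<and> b \<in> space \<and> ((\<forall>y\<in>space. killing a y = 0) \<or> br a x = 0)}" for u
    using that
  proof (induction rule: span_induct_alt)
    case (step c u w)
    then have "trace (\<lambda>v. br u (D v)) = 0" using tr_br by blast
    then show ?case using step.IH by (simp add: br_add_left br_scale_left trace_add trace_scale)
  qed (simp add: trace_zero)
  \<comment> \<open>On the generalized \<open>l\<close>-eigenspace this is \<open>cnj l\<close>
    times the nilpotent part of \<open>ad x\<close>. Its trace is zero, so \<open>ad x\<close> may
    be replaced by \<open>S\<close> in the trace.\<close>
  let ?h = "\<lambda>v. br x (D v) - S (D v)"
  have h: "endo ?h"
    by (rule endo_diff_fun[OF endo_compose[OF f D(1)] endo_compose[OF S(1) D(1)]])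
  have h_eig: "?h v = scale (cnj l) (shift ?f l v)" if "v \<in> gen_eigenspace ?f l" for l v
    using D(2)[OF that] S(2)[OF that]
    by (simp add: shift_def br_scale_right endo_scale[OF S(1)] scale_right_diff_distrib)
  have "trace ?h = 0"
  proof (rule trace_locally_nilpotent[OF h])
    fix u assume "u \<in> space"
    have "C \<subseteq> {v. \<exists>n. (?h ^^ n) v = 0}"
    proof
      fix c assume c: "c \<in> C"
      let ?s = "shift ?f (ev c)"
      have "(?h ^^ n) c = scale (cnj (ev c) ^ n) ((?s ^^ n) c)" for n
      proof (induction n)
        case (Suc n)
        have "(?s ^^ n) c \<in> gen_eigenspace ?f (ev c)"
          by (rule shift_pow_in_gen_eigenspace[OF f ev[OF c]])
        then show ?case using Suc h_eig by (simp add: endo_scale[OF h] mult.commute del: minus_diff_eq)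
      qed simp
      moreover obtain n where "(?s ^^ n) c = 0" using ev[OF c] by (auto simp: gen_eigenspace_def)
      ultimately show "c \<in> {v. \<exists>n. (?h ^^ n) v = 0}" by (auto intro!: exI[of _ n])
    qed
    then have "span C \<subseteq> {v. \<exists>n. (?h ^^ n) v = 0}"
      using h unfolding endo_def by (intro span_minimal subspace_locally_nilpotent) blast+
    then show "\<exists>n. (?h ^^ n) u = 0" using C_span \<open>u \<in> space\<close> by blast
  qed
  then have "trace (\<lambda>v. S (D v)) = 0" using tr_zero[OF x] by (simp add: trace_diff)
  moreover have "trace (\<lambda>v. S (D v)) = (\<Sum>c\<in>C. representation C (S (D c)) c)"
    by (rule trace_eq_basis_trace[OF finC C(2) C_span endo_compose[OF S(1) D(1)]])
  moreover have "representation C (S (D c)) c = of_real ((cmod (ev c))\<^sup>2)" if c: "c \<in> C" for c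
  proof -
    have "S (D c) = scale (cnj (ev c) * ev c) c"
      using D(2)[OF ev[OF c]] S(2)[OF ev[OF c]] by (simp add: endo_scale[OF S(1)])
    then have "representation C (S (D c)) c = cnj (ev c) * ev c"
      using representation_scale[OF C(2) span_base[OF c]] representation_basis[OF C(2) c] by simp
    then show ?thesis by (simp only: complex_norm_square mult.commute)
  qed
  ultimately have "complex_of_real (\<Sum>c\<in>C. (cmod (ev c))\<^sup>2) = 0" by simp
  then have "(\<Sum>c\<in>C. (cmod (ev c))\<^sup>2) = 0" by (simp only: of_real_eq_0_iff)
  then have "ev c = 0" if "c \<in> C" for c
    using that finC by (simp add: sum_nonneg_eq_0_iff)
  then have "C \<subseteq> gen_eigenspace ?f 0" using ev by fastforce
  then have "span C \<subseteq> gen_eigenspace ?f 0"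
    by (intro span_minimal subspace_gen_eigenspace[OF f])
  then obtain n where "(shift ?f 0 ^^ n) v = 0"
    using v C_span unfolding gen_eigenspace_def by blast
  moreover have "shift ?f 0 = ?f" by (rule ext) (simp add: shift_def)
  ultimately show ?thesis by auto
qed

end

section \<open>Complexification\<close>

text \<open>The complexification is modelled by complex coordinate vectors, the functions on the
  index type that vanish outside \<open>I\<close>.\<close>

definition fun_scale :: "complex \<Rightarrow> ('i \<Rightarrow> complex) \<Rightarrow> 'i \<Rightarrow> complex" where
  "fun_scale c u = (\<lambda>i. c * u i)"

definition unit_fun :: "'i \<Rightarrow> 'i \<Rightarrow> complex" where
  "unit_fun i = (\<lambda>j. if j = i then 1 else 0)"

lemma sum_fun_apply: "(\<Sum>a\<in>A. g a) k = (\<Sum>a\<in>A. g a k)" for g :: "'a \<Rightarrow> 'i \<Rightarrow> complex"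
  by (induction A rule: infinite_finite_induct) simp_all

lemma vector_space_fun_scale: "vector_space fun_scale"
  by unfold_locales (auto simp: fun_scale_def fun_eq_iff algebra_simps)

lemma supported_in_span:
  assumes "finite I" "\<And>k. k \<notin> I \<Longrightarrow> u k = 0"
  shows "u \<in> module.span fun_scale (unit_fun ` I)"
proof -
  interpret vector_space fun_scale by (rule vector_space_fun_scale)
  have "u = (\<Sum>i\<in>I. fun_scale (u i) (unit_fun i))"
  proof
    fix k
    have "(\<Sum>i\<in>I. u i * unit_fun i k) = (\<Sum>i\<in>I. if i = k then u k else 0)"
      by (intro sum.cong) (auto simp: unit_fun_def)
    then show "u k = (\<Sum>i\<in>I. fun_scale (u i) (unit_fun i)) k"
      using assms by (auto simp: sum_fun_apply fun_scale_def)
  qed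
  moreover have "(\<Sum>i\<in>I. fun_scale (u i) (unit_fun i)) \<in> span (unit_fun ` I)"
    by (intro span_sum span_scale span_base) auto
  ultimately show ?thesis by simp
qed

text \<open>The map \<open>h\<close> is a homomorphism of the base field into
  \<open>complex\<close>, later \<open>of_real\<close> or \<open>id\<close>, so the real and the
  complex case share one argument.\<close>

locale embedded_coordinate_lie_algebra = coordinate_lie_algebra scale I e coord br
  for scale :: "'k::field \<Rightarrow> 'v::ab_group_add \<Rightarrow> 'v" and I :: "'i set" and e coord br +
  fixes h :: "'k \<Rightarrow> complex"
  assumes h_add: "h (a + b) = h a + h b"
    and h_mult: "h (a * b) = h a * h b"
    and h_one: "h 1 = 1"
begin

lemma h_zero: "h 0 = 0"
  using h_add[of 0 0] by simp

lemma h_eq_0_iff: "h a = 0 \<longleftrightarrow> a = 0"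
  using h_mult[of a "inverse a"] h_one h_zero by (cases "a = 0") auto

lemma h_minus: "h (- a) = - h a"
  using h_add[of a "- a"] h_zero by (simp add: eq_neg_iff_add_eq_0 add.commute)

lemma h_sum: "h (\<Sum>a\<in>A. g a) = (\<Sum>a\<in>A. h (g a))"
  by (induction A rule: infinite_finite_induct) (simp_all add: h_zero h_add)

lemma two_nonzero: "(2::'k) \<noteq> 0"
proof
  assume "(2::'k) = 0"
  then have "h (1 + 1) = 0" by (simp add: h_zero)
  then show False by (simp only: h_add h_one) simp
qed

definition extend :: "'v \<Rightarrow> 'i \<Rightarrow> complex" where
  "extend v = (\<lambda>i. if i \<in> I then h (coord i v) else 0)"

text \<open>The complex bilinear bracket with the structure constants of \<open>br\<close>, mapped
  by \<open>h\<close>.\<close>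

definition extended_br :: "('i \<Rightarrow> complex) \<Rightarrow> ('i \<Rightarrow> complex) \<Rightarrow> 'i \<Rightarrow> complex" where
  "extended_br u v = (\<Sum>i\<in>I. \<Sum>j\<in>I. fun_scale (u i * v j) (extend (br (e i) (e j))))"

lemma extend_add: "extend (x + y) = extend x + extend y"
  by (rule ext) (simp add: extend_def coord_add h_add)

lemma extend_scale: "extend (scale c x) = fun_scale (h c) (extend x)"
  by (rule ext) (simp add: extend_def coord_scale h_mult fun_scale_def)

lemma extend_zero: "extend 0 = 0"
  by (rule ext) (simp add: extend_def coord_zero h_zero)

lemma extend_minus: "extend (- x) = - extend x"
  using extend_scale[of "- 1" x] by (simp add: h_minus h_one fun_scale_def fun_eq_iff)

lemma extend_diff: "extend (x - y) = extend x - extend y"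
  using extend_add[of "x - y" y] by simp

lemma extend_basis: "i \<in> I \<Longrightarrow> extend (e i) = unit_fun i"
  by (rule ext) (auto simp: extend_def unit_fun_def coord_basis h_zero h_one)

lemma extend_eq_0: 
  assumes "v \<in> space" "extend v = 0" shows "v = 0"
proof -
  have "coord i v = 0" if "i \<in> I" for i
    using fun_cong[OF assms(2), of i] that h_eq_0_iff by (simp add: extend_def)
  then show ?thesis using coord_expansion[OF assms(1)] by simp
qed

lemma extended_br_apply:
  "extended_br u v k = (\<Sum>i\<in>I. \<Sum>j\<in>I. u i * v j * extend (br (e i) (e j)) k)"
  by (simp add: extended_br_def sum_fun_apply fun_scale_def)

lemma extended_br_add_left: "extended_br (u + u') v = extended_br u v + extended_br u' v"
  by (rule ext) (simp add: extended_br_apply distrib_right sum.distrib)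

lemma extended_br_add_right: "extended_br v (u + u') = extended_br v u + extended_br v u'"
  by (rule ext) (simp add: extended_br_apply distrib_right distrib_left sum.distrib)

lemma extended_br_scale_left: "extended_br (fun_scale c u) v = fun_scale c (extended_br u v)"
  by (rule ext) (simp add: extended_br_apply fun_scale_def sum_distrib_left mult.assoc)

lemma extended_br_scale_right: "extended_br v (fun_scale c u) = fun_scale c (extended_br v u)"
  by (rule ext) (simp add: extended_br_apply fun_scale_def sum_distrib_left mult_ac)

lemma extended_br_zero: "extended_br 0 v = 0" "extended_br v 0 = 0"
  by (rule ext, simp add: extended_br_apply)+

lemma extended_br_sum_left: "extended_br (\<Sum>a\<in>A. g a) v = (\<Sum>a\<in>A. extended_br (g a) v)"
  by (induction A rule: infinite_finite_induct) 
    (simp_all add: extended_br_zero extended_br_add_left del: plus_fun_apply zero_fun_apply)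

lemma extended_br_sum_right: "extended_br v (\<Sum>a\<in>A. g a) = (\<Sum>a\<in>A. extended_br v (g a))"
  by (induction A rule: infinite_finite_induct) 
    (simp_all add: extended_br_zero extended_br_add_right del: plus_fun_apply zero_fun_apply)

lemma extended_br_extend:
  assumes "x \<in> space" "y \<in> space"
  shows "extended_br (extend x) (extend y) = extend (br x y)"
proof
  fix k
  show "extended_br (extend x) (extend y) k = extend (br x y) k"
  proof (cases "k \<in> I")
    case True
    have "br x y = br (\<Sum>i\<in>I. scale (coord i x) (e i)) (\<Sum>j\<in>I. scale (coord j y) (e j))"
      using assms by (simp add: coord_expansion)
    also have "\<dots> = (\<Sum>j\<in>I. br (\<Sum>i\<in>I. scale (coord i x) (e i)) (scale (coord j y) (e j)))"
      by (rule endo_sum[OF endo_br])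
    also have "\<dots> = (\<Sum>j\<in>I. \<Sum>i\<in>I. scale (coord j y) (scale (coord i x) (br (e i) (e j))))"
    proof (rule sum.cong[OF refl])
      fix j
      have "endo (\<lambda>x. br x (e j))"
        by (rule endoI) (simp_all add: br_add_left br_scale_left br_in_space)
      then have "br (\<Sum>i\<in>I. scale (coord i x) (e i)) (e j) = (\<Sum>i\<in>I. br (scale (coord i x) (e i)) (e j))"
        by (rule endo_sum)
      then show "br (\<Sum>i\<in>I. scale (coord i x) (e i)) (scale (coord j y) (e j))
          = (\<Sum>i\<in>I. scale (coord j y) (scale (coord i x) (br (e i) (e j))))"
        by (simp add: br_scale_right br_scale_left scale_sum_right)
    qed
    finally have "coord k (br x y)
        = (\<Sum>j\<in>I. \<Sum>i\<in>I. coord j y * (coord i x * coord k (br (e i) (e j))))"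
      using True by (simp add: coord_sum coord_scale mult.assoc)
    also have "\<dots> = (\<Sum>i\<in>I. \<Sum>j\<in>I. coord j y * (coord i x * coord k (br (e i) (e j))))"
      by (rule sum.swap)
    finally show ?thesis using True
      by (simp add: extended_br_apply extend_def h_sum h_mult mult_ac)
  qed (simp add: extended_br_apply extend_def)
qed

text \<open>The defect \<open>J\<close> of the identity is linear in each argument, so it is
  determined by triples of basis vectors, where \<open>br_br\<close> makes it vanish.\<close>

lemma extended_br_jacobi:
  "extended_br (extended_br u v) w
    = extended_br u (extended_br v w) - extended_br v (extended_br u w)"
proof -
  let ?b = extended_br
  have unit: "extend (e i) k = (if k = i then 1 else 0)" if "i \<in> I" for i k
    using extend_basis[OF that] by (simp add: unit_fun_def)
  have left: "?b u v = (\<Sum>i\<in>I. fun_scale (u i) (?b (extend (e i)) v))" for u v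
  proof
    fix k
    have "(\<Sum>l\<in>I. u l * ?b (extend (e l)) v k)
        = (\<Sum>l\<in>I. u l * (\<Sum>i\<in>I. if i = l then \<Sum>j\<in>I. v j * extend (br (e i) (e j)) k else 0))"
      unfolding extended_br_apply
      by (intro sum.cong refl arg_cong2[where f = "(*)"]) (auto simp: unit)
    then show "?b u v k = (\<Sum>i\<in>I. fun_scale (u i) (?b (extend (e i)) v)) k"
      using finite_index
      by (simp add: extended_br_apply[of u v] sum_fun_apply fun_scale_def sum_distrib_left mult.assoc)
  qed
  have right: "?b v u = (\<Sum>i\<in>I. fun_scale (u i) (?b v (extend (e i))))" for u v
  proof
    fix k
    have "(\<Sum>l\<in>I. u l * ?b v (extend (e l)) k)
        = (\<Sum>l\<in>I. u l * (\<Sum>i\<in>I. \<Sum>j\<in>I. if j = l then v i * extend (br (e i) (e j)) k else 0))"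
      unfolding extended_br_apply
      by (intro sum.cong refl arg_cong2[where f = "(*)"]) (auto simp: unit)
    also have "\<dots> = (\<Sum>l\<in>I. \<Sum>i\<in>I. v i * u l * extend (br (e i) (e l)) k)"
      using finite_index by (simp add: sum_distrib_left mult_ac)
    also have "\<dots> = ?b v u k" unfolding extended_br_apply by (rule sum.swap)
    finally show "?b v u k = (\<Sum>i\<in>I. fun_scale (u i) (?b v (extend (e i)))) k"
      by (simp add: sum_fun_apply fun_scale_def)
  qed
  have scale_diff: "fun_scale c x - fun_scale c y = fun_scale c (x - y)" for c and x y :: "'i \<Rightarrow> complex"
    by (rule ext) (simp add: fun_scale_def right_diff_distrib)
  define J where "J u v w = ?b (?b u v) w - (?b u (?b v w) - ?b v (?b u w))" for u v w
  have J_left: "J u v w = (\<Sum>i\<in>I. fun_scale (u i) (J (extend (e i)) v w))" for u v w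
  proof -
    have "?b (?b u v) w = (\<Sum>i\<in>I. fun_scale (u i) (?b (?b (extend (e i)) v) w))"
      by (subst left[of u v]) (simp only: extended_br_sum_left extended_br_scale_left)
    moreover have "?b u (?b v w) = (\<Sum>i\<in>I. fun_scale (u i) (?b (extend (e i)) (?b v w)))"
      by (rule left)
    moreover have "?b v (?b u w) = (\<Sum>i\<in>I. fun_scale (u i) (?b v (?b (extend (e i)) w)))"
      by (subst left[of u w]) (simp only: extended_br_sum_right extended_br_scale_right)
    ultimately show ?thesis by (simp add: J_def sum_subtractf scale_diff[symmetric])
  qed
  have J_mid: "J u v w = (\<Sum>i\<in>I. fun_scale (v i) (J u (extend (e i)) w))" for u v w
  proof -
    have "?b (?b u v) w = (\<Sum>i\<in>I. fun_scale (v i) (?b (?b u (extend (e i))) w))"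
      by (subst right[of u v]) (simp only: extended_br_sum_left extended_br_scale_left)
    moreover have "?b v (?b u w) = (\<Sum>i\<in>I. fun_scale (v i) (?b (extend (e i)) (?b u w)))"
      by (rule left)
    moreover have "?b u (?b v w) = (\<Sum>i\<in>I. fun_scale (v i) (?b u (?b (extend (e i)) w)))"
      by (subst left[of v w]) (simp only: extended_br_sum_right extended_br_scale_right)
    ultimately show ?thesis by (simp add: J_def sum_subtractf scale_diff[symmetric])
  qed
  have J_right: "J u v w = (\<Sum>i\<in>I. fun_scale (w i) (J u v (extend (e i))))" for u v w
  proof -
    have "?b (?b u v) w = (\<Sum>i\<in>I. fun_scale (w i) (?b (?b u v) (extend (e i))))"
      by (rule right)
    moreover have "?b v (?b u w) = (\<Sum>i\<in>I. fun_scale (w i) (?b v (?b u (extend (e i)))))"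
      by (subst right[of u w]) (simp only: extended_br_sum_right extended_br_scale_right)
    moreover have "?b u (?b v w) = (\<Sum>i\<in>I. fun_scale (w i) (?b u (?b v (extend (e i)))))"
      by (subst right[of v w]) (simp only: extended_br_sum_right extended_br_scale_right)
    ultimately show ?thesis by (simp add: J_def sum_subtractf scale_diff[symmetric])
  qed
  have J_basis: "J (extend (e i)) (extend (e j)) (extend (e l)) = 0"
    if "i \<in> I" "j \<in> I" "l \<in> I" for i j l
    using that
    by (simp add: J_def extended_br_extend basis_in_space br_in_space br_br extend_diff)
  have fun_scale_zero: "fun_scale c 0 = 0" for c :: complex
    by (rule ext) (simp add: fun_scale_def)
  have "J (extend (e i)) (extend (e j)) w = 0" if "i \<in> I" "j \<in> I" for i j
    by (subst J_right) (simp add: J_basis that fun_scale_zero)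
  then have "J (extend (e i)) v w = 0" if "i \<in> I" for i
    by (subst J_mid) (simp add: that fun_scale_zero)
  then have "J u v w = 0"
    by (subst J_left) (simp add: fun_scale_zero)
  then show ?thesis by (simp add: J_def)
qed

lemma extended_br_self: "extended_br u u = 0"
proof
  fix k
  let ?s = "\<Sum>i\<in>I. \<Sum>j\<in>I. u i * u j * extend (br (e i) (e j)) k"
  have "?s = (\<Sum>j\<in>I. \<Sum>i\<in>I. u i * u j * extend (br (e i) (e j)) k)" by (rule sum.swap)
  also have "\<dots> = (\<Sum>j\<in>I. \<Sum>i\<in>I. - (u j * u i * extend (br (e j) (e i)) k))"
  proof (intro sum.cong refl)
    fix i j
    have "extend (br (e i) (e j)) = - extend (br (e j) (e i))"
      by (subst br_commute) (rule extend_minus)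
    then show "u i * u j * extend (br (e i) (e j)) k = - (u j * u i * extend (br (e j) (e i)) k)"
      by simp
  qed
  also have "\<dots> = - ?s" by (simp add: sum_negf)
  finally have "?s = 0" by simp
  then show "extended_br u u k = 0 k" by (simp add: extended_br_apply)
qed

lemma complexification:
  "complex_coordinate_lie_algebra fun_scale I unit_fun (\<lambda>i u. u i) extended_br"
proof -
  interpret F: vector_space fun_scale by (rule vector_space_fun_scale)
  interpret CS: coordinate_space fun_scale I unit_fun "\<lambda>i u. u i"
    by unfold_locales (auto simp: fun_scale_def unit_fun_def finite_index)
  show ?thesis
  proof unfold_locales
    show "extended_br x y \<in> CS.space" for x y
      unfolding CS.space_def using finite_index
      by (rule supported_in_span) (simp add: extended_br_apply extend_def)
  qed (simp_all add: extended_br_add_left extended_br_add_right extended_br_scale_left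
      extended_br_scale_right extended_br_self extended_br_jacobi)
qed

text \<open>Nilpotency descends from the complexification since \<open>extend\<close> respects
  brackets and is injective on \<open>space\<close>. The hypothesis ascends because
  \<open>extend\<close> carries one Killing form to the other through \<open>h\<close>.\<close>

lemma ad_nilpotent:
  assumes x: "x \<in> span {br a b | a b. a \<in> space \<and> b \<in> space \<and>
      ((\<forall>y\<in>space. killing a y = 0) \<or> br a x = 0)}"
    and v: "v \<in> space"
  shows "\<exists>n. (br x ^^ n) v = 0"
proof -
  interpret C: complex_coordinate_lie_algebra fun_scale I unit_fun "\<lambda>i u. u i" extended_br
    by (rule complexification)
  have x_space: "x \<in> space"
  proof -
    have "span {br a b | a b. a \<in> space \<and> b \<in> space \<and>
      ((\<forall>y\<in>space. killing a y = 0) \<or> br a x = 0)} \<subseteq> space"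
      using subspace_space br_in_space by (intro span_minimal) auto
    then show ?thesis using x by blast
  qed
  have ext_space: "extend y \<in> C.space" for y
    unfolding C.space_def using finite_index by (rule supported_in_span) (simp add: extend_def)
  have kill: "C.killing (extend a) (extend b) = h (killing a b)" if "a \<in> space" "b \<in> space" for a b
    unfolding C.killing_def C.trace_def killing_def trace_def h_sum
  proof (rule sum.cong[OF refl])
    fix i assume i: "i \<in> I"
    have "extended_br (extend a) (extended_br (extend b) (unit_fun i)) = extend (br a (br b (e i)))"
      using that i by (simp add: extend_basis[symmetric] extended_br_extend basis_in_space br_in_space)
    then show "extended_br (extend a) (extended_br (extend b) (unit_fun i)) i
        = h (coord i (br a (br b (e i))))"
      using i by (simp add: extend_def)
  qed
  \<comment> \<open>By linearity in \<open>w\<close> the extended basis vectors suffice, and on them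
    the value is \<open>h 0\<close>.\<close>
  have kill_zero: "C.killing (extend a) w = 0"
    if a: "a \<in> space" "\<forall>y\<in>space. killing a y = 0" and w: "w \<in> C.space" for a w
    using w unfolding C.space_def
  proof (induction rule: C.span_induct_alt)
    case (step c u w)
    then obtain i where "i \<in> I" "u = extend (e i)" by (auto simp: extend_basis)
    then have "C.killing (extend a) u = 0" using a kill basis_in_space h_zero by simp
    then show ?case using step.IH 
      by (simp add: C.killing_add_right C.killing_scale_right del: plus_fun_apply zero_fun_apply)
  qed (simp del: zero_fun_apply)
  let ?G = "{extended_br a b | a b. a \<in> C.space \<and> b \<in> C.space \<and>
      ((\<forall>y\<in>C.space. C.killing a y = 0) \<or> extended_br a (extend x) = 0)}"
  have "extend y \<in> C.span ?G"
    if "y \<in> span {br a b | a b. a \<in> space \<and> b \<in> space \<and>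
      ((\<forall>y\<in>space. killing a y = 0) \<or> br a x = 0)}" for y
    using that
  proof (induction rule: span_induct_alt)
    case base
    then show ?case by (simp add: extend_zero C.span_zero del: zero_fun_apply)
  next
    case (step c u w)
    then obtain a b where ab: "u = br a b" "a \<in> space" "b \<in> space"
      "(\<forall>y\<in>space. killing a y = 0) \<or> br a x = 0" by blast
    have "(\<forall>y\<in>C.space. C.killing (extend a) y = 0) \<or> extended_br (extend a) (extend x) = 0"
      using ab(4)
    proof
      assume "br a x = 0"
      then show ?thesis using extended_br_extend[OF ab(2) x_space]
        by (simp add: extend_zero del: zero_fun_apply)
    qed (use kill_zero[OF ab(2)] in blast)
    moreover have "extend u = extended_br (extend a) (extend b)"
      using ab by (simp add: extended_br_extend)
    ultimately have "extend u \<in> ?G" using ext_space by blast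
    then have "extend u \<in> C.span ?G" by (rule C.span_base)
    then show ?case
      using step.IH by (simp add: extend_add extend_scale C.span_add C.span_scale
          del: plus_fun_apply zero_fun_apply)
  qed
  from C.ad_nilpotent_complex[OF this[OF x] ext_space]
  obtain n where n: "(extended_br (extend x) ^^ n) (extend v) = 0" by blast
  have pow: "(br x ^^ m) v \<in> space \<and> (extended_br (extend x) ^^ m) (extend v) = extend ((br x ^^ m) v)" for m
    by (induction m) (simp_all add: v br_in_space extended_br_extend x_space)
  then have "(br x ^^ n) v = 0" using n extend_eq_0 by metis
  then show ?thesis by blast
qed

end

section \<open>Reductive subalgebras\<close>

context coordinate_lie_algebra
begin

text \<open>For a subalgebra \<open>K\<close>, this and \<open>reductive_on\<close> mirror
  \<open>invariant_subspace\<close> and \<open>completely_reducible\<close> of the adjoint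
  representation, with one bracket for all subalgebras.\<close>

definition ideal_in :: "'v set \<Rightarrow> 'v set \<Rightarrow> bool" where
  "ideal_in K W \<longleftrightarrow> subspace W \<and> W \<subseteq> K \<and> (\<forall>x\<in>K. \<forall>w\<in>W. br x w \<in> W)"

definition reductive_on :: "'v set \<Rightarrow> bool" where
  "reductive_on K \<longleftrightarrow> (\<forall>W. ideal_in K W \<longrightarrow>
    (\<exists>W'. ideal_in K W' \<and> W \<inter> W' = {0} \<and> K = {w + w' | w w'. w \<in> W \<and> w' \<in> W'}))"

definition center :: "'v set" where
  "center = {x \<in> space. \<forall>y\<in>space. br x y = 0}"

definition derived :: "'v set \<Rightarrow> 'v set" where
  "derived K = span {br x y | x y. x \<in> K \<and> y \<in> K}"

lemma br_eq_0_commute: "br x y = 0 \<longleftrightarrow> br y x = 0"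
  by (metis br_commute neg_0_equal_iff_equal)

lemma ideal_in_right: "ideal_in K W \<Longrightarrow> x \<in> K \<Longrightarrow> w \<in> W \<Longrightarrow> br w x \<in> W"
  unfolding ideal_in_def by (metis br_commute subspace_neg)

text \<open>An element \<open>c\<close> of the span lies in \<open>A\<close>, so
  \<open>br c x\<close> is itself one of the generators, and \<open>br x c\<close> is its
  negative.\<close>

lemma ideal_in_span_br:
  assumes A: "ideal_in K A" and K: "subspace K"
  shows "ideal_in K (span {br a y | a y. a \<in> A \<and> y \<in> K})"
    and "span {br a y | a y. a \<in> A \<and> y \<in> K} \<subseteq> A"
proof -
  let ?N = "span {br a y | a y. a \<in> A \<and> y \<in> K}"
  show NA: "?N \<subseteq> A"
    using ideal_in_right[OF A] A by (intro span_minimal) (auto simp: ideal_in_def)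
  have "br x c \<in> ?N" if "x \<in> K" "c \<in> ?N" for x c
  proof -
    have "br c x \<in> ?N" using that NA by (intro span_base) blast
    then show ?thesis by (subst br_commute) (rule span_neg)
  qed
  then show "ideal_in K ?N" using NA A by (auto simp: ideal_in_def)
qed

lemma ideal_in_center: "ideal_in space center"
proof -
  have "subspace center"
    using subspace_space unfolding center_def subspace_def by (auto simp: br_add_left br_scale_left)
  moreover have "br x z \<in> center" if "x \<in> space" "z \<in> center" for x z
  proof -
    have "br x z = 0" using that br_eq_0_commute[of x z] by (simp add: center_def)
    then show ?thesis using \<open>subspace center\<close> subspace_0 by simp
  qed
  ultimately show ?thesis by (auto simp: ideal_in_def center_def)
qed

lemma ideals_commute:
  assumes "ideal_in K V" "ideal_in K W" "V \<inter> W = {0}" "v \<in> V" "w \<in> W"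
  shows "br v w = 0"
proof -
  have "v \<in> K" "w \<in> K" using assms by (auto simp: ideal_in_def)
  then have "br v w \<in> V" "br v w \<in> W"
    using assms ideal_in_right[OF assms(1)] by (auto simp: ideal_in_def)
  then show ?thesis using assms(3) by blast
qed

lemma reductive_on_complement:
  assumes "reductive_on K" "ideal_in K W"
  obtains W' where "ideal_in K W'" "W \<inter> W' = {0}" "K = {w + w' | w w'. w \<in> W \<and> w' \<in> W'}"
proof -
  have "\<exists>W'. ideal_in K W' \<and> W \<inter> W' = {0} \<and> K = {w + w' | w w'. w \<in> W \<and> w' \<in> W'}"
    using assms by (simp only: reductive_on_def)
  then show thesis by (elim exE conjE) (rule that)
qed

text \<open>Modulo the center, \<open>v\<close> may be taken in a complementary ideal
  \<open>S\<close>; its brackets then lie in both \<open>S\<close> and the center, hence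
  vanish.\<close>

lemma second_center_eq_center:
  assumes red: "reductive_on space" and v: "v \<in> space" "\<And>y. y \<in> space \<Longrightarrow> br y v \<in> center"
  shows "v \<in> center"
proof -
  obtain S where S: "ideal_in space S" "center \<inter> S = {0}"
    "space = {z + s | z s. z \<in> center \<and> s \<in> S}"
    by (rule reductive_on_complement[OF red ideal_in_center])
  obtain z s where zs: "v = z + s" "z \<in> center" "s \<in> S" using v(1) S(3) by blast
  have "br s y = 0" if "y \<in> space" for y
  proof -
    have "br z y = 0" using zs(2) that by (simp add: center_def)
    then have "br y v = br y s" using br_eq_0_commute[of z y] by (simp add: zs(1) br_add_right)
    then have "br y s \<in> center" using v(2)[of y] \<open>y \<in> space\<close> by simp
    moreover have "br y s \<in> S" using S(1) that zs(3) by (simp add: ideal_in_def)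
    ultimately have "br y s = 0" using S(2) by blast
    then show ?thesis using br_eq_0_commute by blast
  qed
  then have "s \<in> center" using S(1) zs(3) by (auto simp: center_def ideal_in_def)
  then have "s = 0" using S(2) zs(3) by blast
  then show ?thesis using zs by simp
qed

text \<open>Central summands do not affect brackets, so all brackets fall into the ideal
  complementary to the center.\<close>

lemma center_derived_trivial:
  assumes red: "reductive_on space" and x: "x \<in> center" "x \<in> derived space"
  shows "x = 0"
proof -
  obtain S where S: "ideal_in space S" "center \<inter> S = {0}"
    "space = {z + s | z s. z \<in> center \<and> s \<in> S}"
    by (rule reductive_on_complement[OF red ideal_in_center])
  have "br a b \<in> S" if a: "a \<in> space" and b: "b \<in> space" for a b
  proof -
    obtain z s where zs: "b = z + s" "z \<in> center" "s \<in> S" using b S(3) by blast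
    have "br a z = 0" using zs(2) a br_eq_0_commute[of a z] by (simp add: center_def)
    then have "br a b = br a s" by (simp add: zs(1) br_add_right)
    then show ?thesis using S(1) a zs(3) by (simp add: ideal_in_def)
  qed
  then have "derived space \<subseteq> S"
    using S(1) unfolding derived_def by (intro span_minimal) (auto simp: ideal_in_def)
  then show ?thesis using x S(2) by blast
qed

end

section \<open>Radicals of the Killing form and complements of ideals\<close>

context embedded_coordinate_lie_algebra
begin

lemma killing_radical_central:
  assumes red: "reductive_on space" and x: "x \<in> space" "\<And>y. y \<in> space \<Longrightarrow> killing x y = 0"
  shows "x \<in> center"
proof -
  define R where "R = {x \<in> space. \<forall>y\<in>space. killing x y = 0}"
  have R: "ideal_in space R"
    unfolding ideal_in_def
  proof (intro conjI ballI)
    show "subspace R"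
      using subspace_space unfolding R_def subspace_def
      by (auto simp: killing_add_left killing_scale_left)
    show "R \<subseteq> space" by (auto simp: R_def)
    fix u r assume u: "u \<in> space" and r: "r \<in> R"
    have "killing (br u r) y = 0" if "y \<in> space" for y
    proof -
      have "killing (br r u) y = 0" using r br_in_space by (simp add: killing_invariant R_def)
      then show ?thesis
        using killing_scale_left[of "- 1" "br r u" y] br_commute[of u r] by simp
    qed
    then show "br u r \<in> R" by (simp add: R_def br_in_space)
  qed
  \<comment> \<open>Elements of \<open>Q\<close> are sums of brackets with a left factor in the
    radical, which is the first alternative in \<open>ad_nilpotent\<close>; elements of
    \<open>R\<close> need not have this form.\<close>
  define Q where "Q = span {br r y | r y. r \<in> R \<and> y \<in> space}"
  have Q: "ideal_in space Q"
    unfolding Q_def by (rule ideal_in_span_br(1)[OF R subspace_space])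
  have nil: "\<exists>n. (br q ^^ n) v = 0" if q: "q \<in> Q" and v: "v \<in> space" for q v
  proof (rule ad_nilpotent[OF _ v])
    have "{br r y | r y. r \<in> R \<and> y \<in> space} \<subseteq> {br a b | a b. a \<in> space \<and> b \<in> space \<and>
        ((\<forall>y\<in>space. killing a y = 0) \<or> br a q = 0)}" unfolding R_def by blast
    then show "q \<in> span {br a b | a b. a \<in> space \<and> b \<in> space \<and>
        ((\<forall>y\<in>space. killing a y = 0) \<or> br a q = 0)}"
      using q span_mono unfolding Q_def by blast
  qed
  \<comment> \<open>Otherwise Engel's theorem gives a noncentral \<open>v \<in> Q\<close> with
    \<open>[Q, v]\<close> central. A complementary ideal of \<open>Q\<close> commutes with
    \<open>v\<close>, so all of \<open>[\<gg>, v]\<close> is central, contradicting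
    \<open>second_center_eq_center\<close>.\<close>
  have "Q \<subseteq> center"
  proof (rule ccontr)
    assume "\<not> Q \<subseteq> center"
    then have proper: "Q \<inter> center \<subset> Q" by blast
    have Qsub: "subspace Q" "Q \<subseteq> space" and Qbr: "\<And>x y. x \<in> space \<Longrightarrow> y \<in> Q \<Longrightarrow> br x y \<in> Q"
      using Q by (auto simp: ideal_in_def)
    have Zsub: "subspace center" and Zbr: "\<And>x y. x \<in> space \<Longrightarrow> y \<in> center \<Longrightarrow> br x y \<in> center"
      using ideal_in_center by (auto simp: ideal_in_def)
    have "\<exists>v\<in>Q - Q \<inter> center. \<forall>x\<in>Q. br x v \<in> Q \<inter> center"
    proof (rule engel)
      show "subspace (Q \<inter> center)" using Qsub(1) Zsub by (rule subspace_inter)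
    qed (use Qsub Qbr Zbr nil proper in blast)+
    then obtain v where v: "v \<in> Q" "v \<notin> center" "\<And>q. q \<in> Q \<Longrightarrow> br q v \<in> center" by blast
    obtain C where C: "ideal_in space C" "Q \<inter> C = {0}" "space = {q + c | q c. q \<in> Q \<and> c \<in> C}"
      by (rule reductive_on_complement[OF red Q])
    have "br y v \<in> center" if y: "y \<in> space" for y
    proof -
      obtain q c where qc: "y = q + c" "q \<in> Q" "c \<in> C" using y C(3) by blast
      have "br v c = 0" by (rule ideals_commute[OF Q C(1,2) v(1) qc(3)])
      then have "br c v = 0" using br_eq_0_commute by blast
      then show ?thesis using v(3)[OF qc(2)] by (simp add: qc(1) br_add_left)
    qed
    then have "v \<in> center" using second_center_eq_center[OF red] v(1) Qsub(2) by blast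
    then show False using v(2) by blast
  qed
  moreover have "br y x \<in> Q" if "y \<in> space" for y
  proof -
    have "x \<in> R" using x by (simp add: R_def)
    then have "br x y \<in> Q" unfolding Q_def using that by (intro span_base) blast
    then show ?thesis unfolding Q_def by (subst br_commute) (rule span_neg)
  qed
  ultimately show ?thesis using second_center_eq_center[OF red x(1)] by blast
qed

text \<open>Here \<open>killing\<close> is the form of the whole algebra, not that of
  \<open>K\<close>. The involution enters only later, to verify the assumption
  \<open>radical\<close>.\<close>

lemma reductive_subalgebra:
  assumes red: "reductive_on space"
    and K: "subspace K" "K \<subseteq> space" "\<And>x y. x \<in> K \<Longrightarrow> y \<in> K \<Longrightarrow> br x y \<in> K"
    and radical: "\<And>x. x \<in> K \<Longrightarrow> (\<And>y. y \<in> K \<Longrightarrow> killing x y = 0) \<Longrightarrow> x \<in> center"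
  shows "reductive_on K"
  unfolding reductive_on_def
proof (intro allI impI)
  fix P assume P: "ideal_in K P"
  define M where "M = derived K"
  have KK: "ideal_in K K" using K by (simp add: ideal_in_def)
  have M: "ideal_in K M" "M \<subseteq> K"
    unfolding M_def derived_def using ideal_in_span_br[OF KK K(1)] by auto
  have M_base: "br x y \<in> M" if "x \<in> K" "y \<in> K" for x y
    unfolding M_def derived_def using that by (intro span_base) blast
  have M_derived: "M \<subseteq> derived space"
    unfolding M_def derived_def using K(2) by (intro span_mono) blast
  \<comment> \<open>An element of \<open>[K, K]\<close> orthogonal to \<open>K\<close> is central
    and lies in the derived algebra of the reductive algebra, where the center is trivial.\<close>
  have M_zero: "x = 0" if x: "x \<in> M" "\<And>y. y \<in> K \<Longrightarrow> killing x y = 0" for x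
    using center_derived_trivial[OF red radical] x M(2) M_derived by blast
  define N where "N = P \<inter> M"
  have N: "ideal_in K N"
    using P M(1) subspace_inter unfolding N_def ideal_in_def by blast
  have orth: "ideal_in K {y \<in> T. \<forall>n\<in>N. killing y n = 0}" if T: "ideal_in K T" for T
    unfolding ideal_in_def
  proof (intro conjI ballI)
    show "subspace {y \<in> T. \<forall>n\<in>N. killing y n = 0}"
      using T unfolding ideal_in_def subspace_def by (auto simp: killing_add_left killing_scale_left)
    show "{y \<in> T. \<forall>n\<in>N. killing y n = 0} \<subseteq> K" using T by (auto simp: ideal_in_def)
    fix x a assume x: "x \<in> K" and a: "a \<in> {y \<in> T. \<forall>n\<in>N. killing y n = 0}"
    have "killing (br x a) n = 0" if n: "n \<in> N" for n
    proof -
      have "br x n \<in> N" using N x n by (simp add: ideal_in_def)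
      then have "killing (br a x) n = 0" using a by (simp add: killing_invariant)
      then show ?thesis using killing_scale_left[of "- 1" "br a x" n] br_commute[of x a] by simp
    qed
    then show "br x a \<in> {y \<in> T. \<forall>n\<in>N. killing y n = 0}" using T x a by (simp add: ideal_in_def)
  qed
  define A where "A = {a \<in> N. \<forall>n\<in>N. killing a n = 0}"
  have A: "ideal_in K A" unfolding A_def by (rule orth[OF N])
  have AN: "A \<subseteq> N" and AM: "A \<subseteq> M" unfolding A_def N_def by blast+
  have AK: "A \<subseteq> K" using AM M(2) by (rule order.trans)
  \<comment> \<open>Invariance moves \<open>b\<close> across: \<open>killing (br a b) y\<close>
    equals \<open>killing a (br b y)\<close>, where \<open>br b y\<close> is in \<open>N\<close> and
    \<open>a\<close> is orthogonal to \<open>N\<close>.\<close>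
  have A_abelian: "br a b = 0" if "a \<in> A" "b \<in> A" for a b
  proof (rule M_zero)
    show "br a b \<in> M" using that AK M_base by blast
    fix y assume "y \<in> K"
    then have "br b y \<in> N" using that(2) ideal_in_right[OF A] AN by blast
    then show "killing (br a b) y = 0" using that(1) by (simp add: killing_invariant A_def)
  qed
  define B where "B = span {br a y | a y. a \<in> A \<and> y \<in> K}"
  have B: "ideal_in K B" and BA: "B \<subseteq> A"
    unfolding B_def using ideal_in_span_br[OF A K(1)] by auto
  have nilideal: "W \<subseteq> {0}"
    if W: "ideal_in K W" "W \<subseteq> M"
      and nil: "\<And>c v. c \<in> W \<Longrightarrow> v \<in> space \<Longrightarrow> \<exists>n. (br c ^^ n) v = 0" for W
  proof
    fix c assume c: "c \<in> W"
    have "killing c y = 0" if "y \<in> K" for y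
      using W nil K(2) c that unfolding ideal_in_def
      by (intro killing_zero_of_nilpotent_ideal[of K W]) blast+
    then show "c \<in> {0}" using M_zero c W(2) by blast
  qed
  have "B \<subseteq> {0}"
  proof (rule nilideal[OF B])
    show "B \<subseteq> M" using BA AM by blast
    fix c v assume c: "c \<in> B" and v: "v \<in> space"
    \<comment> \<open>Since \<open>c\<close> lies in the abelian ideal \<open>A\<close>, every left
      factor \<open>a\<close> commutes with \<open>c\<close>. This is the second alternative in
      \<open>ad_nilpotent\<close>.\<close>
    have "{br a y | a y. a \<in> A \<and> y \<in> K} \<subseteq> {br a b | a b. a \<in> space \<and> b \<in> space \<and>
        ((\<forall>y\<in>space. killing a y = 0) \<or> br a c = 0)}"
      using A_abelian c BA AK K(2) by blast
    then show "\<exists>n. (br c ^^ n) v = 0"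
      using c span_mono unfolding B_def by (intro ad_nilpotent[OF _ v]) blast
  qed
  then have A_central: "br a y = 0" if "a \<in> A" "y \<in> K" for a y
    using that span_base[of "br a y" "{br a y | a y. a \<in> A \<and> y \<in> K}"] unfolding B_def by blast
  have A_zero: "A \<subseteq> {0}"
  proof (rule nilideal[OF A AM])
    fix c v assume c: "c \<in> A" and v: "v \<in> space"
    have "br x c = 0" if "x \<in> K" for x
      using A_central[OF c that] br_eq_0_commute by blast
    \<comment> \<open>Now that \<open>A\<close> commutes with \<open>K\<close>, every left factor in
      an expression of \<open>c \<in> [K, K]\<close> commutes with \<open>c\<close>, so the second
      alternative applies again.\<close>
    then have "{br x y | x y. x \<in> K \<and> y \<in> K} \<subseteq> {br a b | a b. a \<in> space \<and> b \<in> space \<and>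
        ((\<forall>y\<in>space. killing a y = 0) \<or> br a c = 0)}"
      using K(2) by blast
    moreover have "c \<in> span {br x y | x y. x \<in> K \<and> y \<in> K}"
      using c AM unfolding M_def derived_def by blast
    ultimately show "\<exists>n. (br c ^^ n) v = 0"
      using span_mono by (intro ad_nilpotent[OF _ v]) blast
  qed
  define N' where "N' = {y \<in> K. \<forall>n\<in>N. killing y n = 0}"
  have N': "ideal_in K N'" unfolding N'_def by (rule orth[OF KK])
  have decomp: "\<exists>n\<in>N. y - n \<in> N'" if y: "y \<in> K" for y
  proof -
    have Nsub: "subspace N" "N \<subseteq> span (e ` I)"
      using N K(2) unfolding ideal_in_def space_def by blast+
    have nondeg: "n = 0" if "n \<in> N" "\<forall>m\<in>N. killing n m = 0" for n
      using that A_zero unfolding A_def by blast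
    obtain n where n: "n \<in> N" "\<forall>m\<in>N. killing (y - n) m = 0"
      by (rule orthogonal_decomposition[where \<beta> = killing and y = y, OF finite_basis Nsub
            killing_add_left killing_scale_left killing_add_right killing_scale_right nondeg])
        (assumption | rule that)+
    have "n \<in> K" using n(1) N by (auto simp: ideal_in_def)
    then have "y - n \<in> K" using subspace_diff[OF K(1) y] by blast
    then show ?thesis using n by (auto simp: N'_def)
  qed
  \<comment> \<open>A subspace between \<open>M \<inter> N'\<close> and \<open>N'\<close> is
    automatically an ideal of \<open>K\<close>, since brackets of \<open>K\<close> with
    \<open>N'\<close> land in \<open>M \<inter> N'\<close>. The search for a complement is thus pure
    linear algebra.\<close>
  define admissible where
    "admissible J \<longleftrightarrow> subspace J \<and> M \<inter> N' \<subseteq> J \<and> J \<subseteq> N' \<and> P \<inter> J \<subseteq> {0}" for J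
  have "P \<inter> (M \<inter> N') \<subseteq> A" using A_def N_def N'_def by blast
  moreover have "subspace (M \<inter> N')"
    using M(1) N' by (intro subspace_inter) (simp_all add: ideal_in_def)
  ultimately have adm: "admissible (M \<inter> N')" using A_zero by (simp add: admissible_def)
  have adm_sub: "subspace J \<and> J \<subseteq> span (e ` I)" if "admissible J" for J
  proof -
    have "J \<subseteq> space" using that K(2) unfolding admissible_def N'_def by blast
    then show ?thesis using that by (simp add: admissible_def space_def)
  qed
  obtain J where J: "admissible J"
    and J_max: "\<forall>J'. admissible J' \<longrightarrow> J \<subseteq> J' \<longrightarrow> J' = J"
    by (rule maximal_subspace_exists[where P = admissible, OF finite_basis adm adm_sub])
      (assumption | rule that)+
  have J_sub: "subspace J" "J \<subseteq> N'" and PJ: "P \<inter> J \<subseteq> {0}" using J by (auto simp: admissible_def)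
  have P_sub: "subspace P" "P \<subseteq> K" using P by (auto simp: ideal_in_def)
  have N'_in: "p \<in> {i + j | i j. i \<in> P \<and> j \<in> J}" if p: "p \<in> N'" for p
  proof (rule ccontr)
    assume np: "p \<notin> {i + j | i j. i \<in> P \<and> j \<in> J}"
    have N'_sub: "subspace N'" using N' by (simp add: ideal_in_def)
    let ?J = "span (insert p J)"
    have JJ: "J \<subseteq> ?J" by (meson span_superset subset_insertI subset_trans)
    have J_N': "?J \<subseteq> N'"
      by (rule span_minimal[OF _ N'_sub]) (simp add: p J_sub(2))
    have "x = 0" if x: "x \<in> P" "x \<in> ?J" for x
    proof -
      \<comment> \<open>A nonzero coefficient \<open>c\<close> would allow solving for
        \<open>p\<close> as a member of \<open>P + J\<close>; hence adjoining \<open>p\<close> keeps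
        the intersection with \<open>P\<close> trivial.\<close>
      obtain c where "x - scale c p \<in> span J" using x(2) by (auto simp: span_breakdown_eq)
      then have c: "x - scale c p \<in> J" using J_sub(1) by (simp add: span_eq_iff[THEN iffD2])
      have "c = 0"
      proof (rule ccontr)
        assume c0: "c \<noteq> 0"
        have i: "scale (inverse c) x \<in> P" using P_sub(1) x(1) by (rule subspace_scale)
        have j: "scale (- inverse c) (x - scale c p) \<in> J" using J_sub(1) c by (rule subspace_scale)
        have "p = scale (inverse c) x + scale (- inverse c) (x - scale c p)"
          using c0 by (simp add: scale_right_diff_distrib)
        then show False using np i j by blast
      qed
      then show ?thesis using c x(1) PJ by auto
    qed
    then have "P \<inter> ?J \<subseteq> {0}" by blast
    moreover have "M \<inter> N' \<subseteq> ?J" using J JJ by (auto simp: admissible_def)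
    ultimately have "admissible ?J" using J_N' by (simp add: admissible_def)
    then have "?J = J" using J_max JJ by simp
    then have "p \<in> J" using span_base[of p "insert p J"] by simp
    moreover have "p = 0 + p" by simp
    ultimately show False using np subspace_0[OF P_sub(1)] by blast
  qed
  have "ideal_in K J"
    unfolding ideal_in_def
  proof (intro conjI ballI)
    show "subspace J" by (rule J_sub)
    show "J \<subseteq> K" using J_sub(2) by (auto simp: N'_def)
    fix x j assume x: "x \<in> K" and j: "j \<in> J"
    have "j \<in> N'" using j J_sub(2) by blast
    then have "br x j \<in> M \<inter> N'" using N' M_base x by (auto simp: ideal_in_def)
    then show "br x j \<in> J" using J by (auto simp: admissible_def)
  qed
  moreover have "P \<inter> J = {0}" using PJ subspace_0[OF P_sub(1)] subspace_0[OF J_sub(1)] by blast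
  moreover have "K = {w + w' | w w'. w \<in> P \<and> w' \<in> J}"
  proof
    show "{w + w' | w w'. w \<in> P \<and> w' \<in> J} \<subseteq> K"
      using P_sub(2) \<open>ideal_in K J\<close> subspace_add[OF K(1)] unfolding ideal_in_def by blast
    show "K \<subseteq> {w + w' | w w'. w \<in> P \<and> w' \<in> J}"
    proof
      fix y assume "y \<in> K"
      then obtain n where n: "n \<in> N" "y - n \<in> N'" using decomp by blast
      then obtain i j where ij: "i \<in> P" "j \<in> J" "y - n = i + j" using N'_in by blast
      have "n + i \<in> P" using n(1) ij(1) subspace_add[OF P_sub(1)] by (auto simp: N_def)
      moreover have "y = (n + i) + j" using ij(3) by (simp add: algebra_simps)
      ultimately show "y \<in> {w + w' | w w'. w \<in> P \<and> w' \<in> J}" using ij(2) by blast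
    qed
  qed
  ultimately show "\<exists>W'. ideal_in K W' \<and> P \<inter> W' = {0} \<and> K = {w + w' | w w'. w \<in> P \<and> w' \<in> W'}"
    by (intro exI conjI)
qed

lemma reductive_involution_fixed_points:
  assumes red: "reductive_on space" and J: "endo J"
    and J_J: "\<And>v. v \<in> space \<Longrightarrow> J (J v) = v"
    and J_br: "\<And>x y. x \<in> space \<Longrightarrow> y \<in> space \<Longrightarrow> J (br x y) = br (J x) (J y)"
  shows "reductive_on {x \<in> space. J x = x}"
proof (rule reductive_subalgebra[OF red])
  let ?K = "{x \<in> space. J x = x}"
  show "subspace ?K"
    using subspace_space unfolding subspace_def
    by (auto simp: endo_zero[OF J] endo_add[OF J] endo_scale[OF J])
  show "?K \<subseteq> space" by blast
  show "br x y \<in> ?K" if "x \<in> ?K" "y \<in> ?K" for x y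
    using that J_br br_in_space by auto
  fix x assume x: "x \<in> ?K" and x0: "\<And>y. y \<in> ?K \<Longrightarrow> killing x y = 0"
  have J_space: "J v \<in> space" for v using J by (rule endo_in_space)
  \<comment> \<open>On \<open>space\<close>, \<open>ad (J x)\<close> is the conjugate of
    \<open>ad x\<close> by \<open>J\<close>, and cyclicity of the trace cancels the
    conjugation.\<close>
  have killing_J: "killing (J x) (J y) = killing x y" if "x \<in> space" "y \<in> space" for x y
  proof -
    have "killing (J x) (J y) = trace (\<lambda>v. J (br x (br y (J v))))"
      unfolding killing_def
      by (rule trace_cong) (simp add: J_br J_J that br_in_space J_space)
    also have "\<dots> = trace (\<lambda>v. br x (br y (J (J v))))"
      by (rule trace_commute[OF J endo_compose[OF endo_br endo_compose[OF endo_br J]]])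
    also have "\<dots> = killing x y"
      unfolding killing_def by (rule trace_cong) (simp add: J_J)
    finally show ?thesis .
  qed
  show "x \<in> center"
  proof (rule killing_radical_central[OF red])
    show "x \<in> space" using x by blast
    fix y assume y: "y \<in> space"
    \<comment> \<open>The sum is fixed by \<open>J\<close>, so \<open>x\<close> is orthogonal to it.
      As \<open>x\<close> is fixed too, both summands contribute the same value, and 2 is
      invertible.\<close>
    have "y + J y \<in> ?K"
      using y J_space subspace_add[OF subspace_space] by (simp add: endo_add[OF J] J_J add.commute)
    then have "killing x y + killing x (J y) = 0"
      using x0 by (simp flip: killing_add_right)
    moreover have "killing x (J y) = killing x y" using killing_J[of x y] x y by simp
    ultimately have "2 * killing x y = 0" by (simp only: mult_2)
    then show "killing x y = 0" using two_nonzero by simp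
  qed
qed

end

section \<open>Fixed points of involutions\<close>

lemma reductive_fixed_points:
  fixes scale :: "'k::field \<Rightarrow> 'v::ab_group_add \<Rightarrow> 'v" and h :: "'k \<Rightarrow> complex"
  assumes h: "\<And>a b. h (a + b) = h a + h b" "\<And>a b. h (a * b) = h a * h b" "h 1 = 1"
    and reductive: "reductive_lie_algebra scale L bracket"
    and fin: "lie_algebra.finite_dimensional scale L"
    and inv: "lie_algebra.involution scale L bracket \<iota>"
  shows "reductive_lie_algebra scale (lie_algebra.fixed_points L \<iota>) bracket"
proof -
  interpret reductive_lie_algebra scale L bracket by (rule reductive)
  obtain B where B: "finite B" "L = span B" using fin unfolding finite_dimensional_def by blast
  obtain C where C: "finite C" "independent C" "span C = L"
    using B by (metis subspace_finite_basis subspace_span subset_refl)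
  obtain p where p: "Vector_Spaces.linear scale scale p" and p_in: "\<And>v. p v \<in> L"
    and p_id: "\<And>v. v \<in> L \<Longrightarrow> p v = v"
    using projection_exists[OF subspace_carrier] by blast
  interpret p: Vector_Spaces.linear scale scale p by (rule p)
  \<comment> \<open>Coordinates refer to a basis of the ambient space extending \<open>C\<close>,
    which makes them linear outside \<open>L\<close> as well.\<close>
  define crd where "crd b v = representation (extend_basis C) v b" for b v
  interpret CS: coordinate_space scale C "\<lambda>b. b" crd
  proof unfold_locales
    note ind = independent_extend_basis[OF C(2)] and sp = span_extend_basis[OF C(2)]
    show "finite C" by (rule C)
    show "crd i (x + y) = crd i x + crd i y" for i x y
      by (simp add: crd_def representation_add[OF ind] sp)
    show "crd i (scale c x) = c * crd i x" for i c x
      by (simp add: crd_def representation_scale[OF ind] sp)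
    show "crd i j = (if i = j then 1 else 0)" if "i \<in> C" "j \<in> C" for i j
      using representation_basis[OF ind, of j] extend_basis_superset[OF C(2)] that
      by (auto simp: crd_def)
  qed
  have space: "CS.space = L" by (simp add: CS.space_def C(3))
  \<comment> \<open>The given bracket is constrained only on \<open>L\<close>; composing with the
    projection \<open>p\<close> makes it bilinear everywhere and changes nothing on
    \<open>L\<close>.\<close>
  define br where "br x y = bracket (p x) (p y)" for x y
  have br_eq: "br x y = bracket x y" if "x \<in> L" "y \<in> L" for x y
    using that by (simp add: br_def p_id)
  interpret E: embedded_coordinate_lie_algebra scale C "\<lambda>b. b" crd br h
  proof unfold_locales
    show "br (br x y) v = br x (br y v) - br y (br x v)" for x y v
      by (simp add: br_def p_id p_in bracket_closed adjoint.action_bracket)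
  qed (simp_all add: br_def p.add p.scale p_in bracket_add_left bracket_add_right
      bracket_scale_left bracket_scale_right bracket_self bracket_closed space h)
  have "E.ideal_in L W \<longleftrightarrow> adjoint.invariant_subspace W" for W
    using br_eq unfolding E.ideal_in_def adjoint.invariant_subspace_def
    by (metis subsetD)
  then have red: "E.reductive_on CS.space"
    using adjoint_completely_reducible
    by (simp only: space E.reductive_on_def adjoint.completely_reducible_def)
  have iota_in: "\<iota> x \<in> L" and iota_iota: "\<iota> (\<iota> x) = x" if "x \<in> L" for x
    using inv that bij_betwE unfolding involution_def automorphism_def by blast+
  have iota_add: "\<iota> (x + y) = \<iota> x + \<iota> y" if "x \<in> L" "y \<in> L" for x y
    using inv that unfolding involution_def automorphism_def by blast
  have iota_scale: "\<iota> (scale c x) = scale c (\<iota> x)" if "x \<in> L" for c x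
    using inv that unfolding involution_def automorphism_def by blast
  have iota_bracket: "\<iota> (bracket x y) = bracket (\<iota> x) (\<iota> y)" if "x \<in> L" "y \<in> L" for x y
    using inv that unfolding involution_def automorphism_def by blast
  define K where "K = fixed_points \<iota>"
  \<comment> \<open>The involution likewise is controlled only on \<open>L\<close>, so
    \<open>\<iota> \<circ> p\<close> takes its place. It has the same fixed points in
    \<open>L\<close>.\<close>
  have "E.reductive_on {x \<in> CS.space. \<iota> (p x) = x}"
  proof (rule E.reductive_involution_fixed_points[OF red])
    show "CS.endo (\<lambda>x. \<iota> (p x))"
      by (rule CS.endoI)
        (simp_all add: p.add p.scale iota_add iota_scale p_in iota_in space)
  qed (simp_all add: br_def space p_id p_in iota_in iota_iota iota_bracket bracket_closed)
  moreover have "{x \<in> CS.space. \<iota> (p x) = x} = K"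
    by (auto simp: space K_def fixed_points_def p_id)
  ultimately have redK: "E.reductive_on K" by simp
  have K_L: "x \<in> L" if "x \<in> K" for x using that by (simp add: K_def fixed_points_def)
  have K_closed: "bracket x y \<in> K" if "x \<in> K" "y \<in> K" for x y
    using that by (simp add: K_def fixed_points_def bracket_closed iota_bracket)
  have "\<iota> 0 = 0" using iota_scale[of 0 0] subspace_0[OF subspace_carrier] by simp
  then have K_sub: "subspace K"
    using subspace_carrier unfolding subspace_def K_def fixed_points_def
    by (simp add: iota_add iota_scale)
  interpret K: lie_algebra scale K bracket
    by unfold_locales
      (simp_all add: K_sub K_closed K_L bracket_add_left bracket_add_right bracket_scale_left
        bracket_scale_right bracket_self jacobi)
  have "E.ideal_in K W \<longleftrightarrow> K.adjoint.invariant_subspace W" for W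
    using br_eq K_L unfolding E.ideal_in_def K.adjoint.invariant_subspace_def
    by (metis subsetD)
  then have "K.adjoint.completely_reducible"
    using redK by (simp only: E.reductive_on_def K.adjoint.completely_reducible_def)
  then show ?thesis
    unfolding K_def[symmetric] by unfold_locales
qed

theorem proposition2p3:
  fixes scale_r :: "real \<Rightarrow> 'a::ab_group_add \<Rightarrow> 'a"
    and scale_c :: "complex \<Rightarrow> 'b::ab_group_add \<Rightarrow> 'b"
  shows
    "(\<forall>\<gg> bracket \<iota>.
        reductive_lie_algebra scale_r \<gg> bracket \<and>
        lie_algebra.finite_dimensional scale_r \<gg> \<and>
        lie_algebra.involution scale_r \<gg> bracket \<iota> \<longrightarrow>
        reductive_lie_algebra scale_r (lie_algebra.fixed_points \<gg> \<iota>) bracket) \<and>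
     (\<forall>\<gg> bracket \<iota>.
        reductive_lie_algebra scale_c \<gg> bracket \<and>
        lie_algebra.finite_dimensional scale_c \<gg> \<and>
        lie_algebra.involution scale_c \<gg> bracket \<iota> \<longrightarrow>
        reductive_lie_algebra scale_c (lie_algebra.fixed_points \<gg> \<iota>) bracket)"
proof (intro conjI allI impI; elim conjE)
  fix \<gg> bracket \<iota>
  assume "reductive_lie_algebra scale_r \<gg> bracket" "lie_algebra.finite_dimensional scale_r \<gg>"
    "lie_algebra.involution scale_r \<gg> bracket \<iota>"
  then show "reductive_lie_algebra scale_r (lie_algebra.fixed_points \<gg> \<iota>) bracket"
    by (rule reductive_fixed_points[where h = of_real, rotated 3]) simp_all
next
  fix \<gg> bracket \<iota>
  assume "reductive_lie_algebra scale_c \<gg> bracket" "lie_algebra.finite_dimensional scale_c \<gg>"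
    "lie_algebra.involution scale_c \<gg> bracket \<iota>"
  then show "reductive_lie_algebra scale_c (lie_algebra.fixed_points \<gg> \<iota>) bracket"
    by (rule reductive_fixed_points[where h = id, rotated 3]) simp_all
qed

end
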